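(* Let $k\in\mathbb{N}$, and let $A\subset\mathbb{N}$ have positive upper density. Then for (Lebesgue-)almost every $\theta\in\mathbb{R}$ and every $\gamma\in\mathbb{R}$ there exists a $k$-term arithmetic progression in $A$ with common difference in the Beatty sequence $\{\lfloor\theta n+\gamma\rfloor:n\in\mathbb{N}\}$.
   Context: The upper density of $A\subset\mathbb{N}$ is $\bar d(A):=\limsup_{N\to\infty}\frac{|A\cap\{1,\dots,N\}|}{N}$. A $k$-term arithmetic progression in $A$ with common difference $d$ is a set $\{m,m+d,\dots,m+(k-1)d\}\subset A$ where $d$ is a non-zero integer (possibly negative). *)

theory Defs
  imports "HOL-Analysis.Analysis"
begin

text \<open>
  The positive integers are rendered as \<open>nat\<close> with explicit positivity conditions.
  Common differences may be negative, so progressions live in \<open>int\<close>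
  and sets of naturals are embedded by \<open>int\<close>.
\<close>

definition upper_density :: "nat set \<Rightarrow> ereal" where
  "upper_density A = limsup (\<lambda>N. ereal (real (card (A \<inter> {1..N})) / real N))"

definition is_AP :: "nat \<Rightarrow> int \<Rightarrow> int set \<Rightarrow> bool" where
  "is_AP k d P \<longleftrightarrow> d \<noteq> 0 \<and> (\<exists>m. P = {m + int i * d | i. i < k})"

definition beatty :: "real \<Rightarrow> real \<Rightarrow> int set" where
  "beatty \<theta> \<gamma> = {\<lfloor>\<theta> * real n + \<gamma>\<rfloor> | n. n \<ge> 1}"

end

theory Submission
  imports Defs
begin

text \<open>
  For an unbounded set \<open>D\<close> of naturals and almost every \<open>\<alpha>\<close> the multiples \<open>d * \<alpha>\<close>
  with \<open>d \<in> D\<close> are dense modulo 1. For \<open>\<theta> > 0\<close>, a large \<open>d\<close> is of the form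
  \<open>\<lfloor>\<theta> n + \<gamma>\<rfloor>\<close> iff \<open>d / \<theta>\<close> lies in a certain interval modulo 1, and for \<open>\<theta> < 0\<close>
  the same holds for \<open>- d\<close>; so it suffices that the common differences of \<open>k\<close>-term
  progressions in \<open>A\<close> are unbounded. That is
  Szemeredi's theorem, which follows from the density Hales-Jewett theorem by mapping a word
  \<open>x\<close> to \<open>a + L * sum_list x\<close>; the differences are then at least \<open>L\<close>.

  The density Hales-Jewett theorem is proved by induction on the alphabet with a density
  increment, along the lines of Polymath and of Dodos, Kanellopoulos and Tyros. A line-free set
  of nearly maximal density over \<open>k + 1\<close> letters has a slice which, up to a negligible part, is
  disjoint from a dense intersection of \<open>(i, k)\<close>-insensitive sets. It is therefore denser than
  allowed on a further intersection of insensitive sets, and hence on a subspace. In place of the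
  Graham-Rothschild theorem, which makes all lines of a subspace good, the good lines are only
  required to have positive measure for some product measure, found by the pigeonhole principle.
\<close>

section \<open>Product measures on words\<close>

definition words :: "nat \<Rightarrow> nat \<Rightarrow> nat list set" where
  "words k n = {xs. set xs \<subseteq> {..<k} \<and> length xs = n}"

text \<open>The expectation of \<open>f\<close> for \<open>n\<close> independent letters of law
  \<open>p\<close>. Splitting off the first letter turns Fubini (\<open>expct_swap\<close>,
  \<open>expct_append\<close>) into plain inductions.\<close>

primrec expct :: "nat \<Rightarrow> (nat \<Rightarrow> real) \<Rightarrow> nat \<Rightarrow> (nat list \<Rightarrow> real) \<Rightarrow> real" where
  "expct k p 0 f = f []"
| "expct k p (Suc n) f = (\<Sum>a<k. p a * expct k p n (\<lambda>x. f (a # x)))"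

definition prob_weights :: "nat \<Rightarrow> (nat \<Rightarrow> real) \<Rightarrow> bool" where
  "prob_weights k p \<longleftrightarrow> (\<forall>a<k. 0 \<le> p a) \<and> (\<Sum>a<k. p a) = 1"

abbreviation unif :: "nat \<Rightarrow> nat \<Rightarrow> real" where
  "unif k \<equiv> \<lambda>_. 1 / real k"

lemma prob_weights_unif: "k \<ge> 1 \<Longrightarrow> prob_weights k (unif k)"
  by (simp add: prob_weights_def)

lemma words_0 [simp]: "words k 0 = {[]}"
  by (auto simp: words_def)

lemma words_Suc: "words k (Suc n) = (\<lambda>(a, x). a # x) ` ({..<k} \<times> words k n)"
proof (intro set_eqI iffI)
  fix x assume "x \<in> words k (Suc n)"
  then show "x \<in> (\<lambda>(a, x). a # x) ` ({..<k} \<times> words k n)"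
    by (cases x) (auto simp: words_def)
qed (auto simp: words_def)

lemma Cons_in_words [simp]: "a # x \<in> words k (Suc n) \<longleftrightarrow> a < k \<and> x \<in> words k n"
  by (auto simp: words_def)

lemma words_append: "x \<in> words k m \<Longrightarrow> y \<in> words k n \<Longrightarrow> x @ y \<in> words k (m + n)"
  by (auto simp: words_def)

lemma words_length: "x \<in> words k n \<Longrightarrow> length x = n"
  by (simp add: words_def)

lemma words_set: "x \<in> words k n \<Longrightarrow> a \<in> set x \<Longrightarrow> a < k"
  by (auto simp: words_def)

lemma words_mono: "k \<le> k' \<Longrightarrow> words k n \<subseteq> words k' n"
  by (auto simp: words_def)

lemma finite_words [simp]: "finite (words k n)"
  unfolding words_def by (rule finite_lists_length_eq) simp

lemma card_words: "card (words k n) = k ^ n"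
  unfolding words_def by (subst card_lists_length_eq) simp_all

lemma map_words: "x \<in> words k n \<Longrightarrow> (\<And>a. a < k \<Longrightarrow> g a < l) \<Longrightarrow> map g x \<in> words l n"
  by (auto simp: words_def)

lemma expct_cong:
  "(\<And>x. x \<in> words k n \<Longrightarrow> f x = g x) \<Longrightarrow> expct k p n f = expct k p n g"
proof (induction n arbitrary: f g)
  case (Suc n)
  have "expct k p n (\<lambda>x. f (a # x)) = expct k p n (\<lambda>x. g (a # x))" if "a < k" for a
    by (rule Suc.IH) (simp add: Suc.prems that)
  then show ?case by simp
qed simp

lemma expct_mono:
  assumes "prob_weights k p"
  shows "(\<And>x. x \<in> words k n \<Longrightarrow> f x \<le> g x) \<Longrightarrow> expct k p n f \<le> expct k p n g"
proof (induction n arbitrary: f g)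
  case (Suc n)
  have "expct k p n (\<lambda>x. f (a # x)) \<le> expct k p n (\<lambda>x. g (a # x))" if "a < k" for a
    by (rule Suc.IH) (simp add: Suc.prems that)
  then show ?case using assms by (auto intro!: sum_mono mult_left_mono simp: prob_weights_def)
qed simp

lemma expct_add: "expct k p n (\<lambda>x. f x + g x) = expct k p n f + expct k p n g"
  by (induction n arbitrary: f g) (simp_all add: sum.distrib algebra_simps)

lemma expct_cmult: "expct k p n (\<lambda>x. c * f x) = c * expct k p n f"
  by (induction n arbitrary: f) (simp_all add: sum_distrib_left algebra_simps)

lemma expct_diff: "expct k p n (\<lambda>x. f x - g x) = expct k p n f - expct k p n g"
  using expct_add[of k p n f "\<lambda>x. (-1) * g x"] expct_cmult[of k p n "-1" g] by simp

lemma expct_const: "prob_weights k p \<Longrightarrow> expct k p n (\<lambda>_. c) = c"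
  by (induction n) (simp_all add: prob_weights_def flip: sum_distrib_right)

lemma expct_sum: "expct k p n (\<lambda>x. \<Sum>i\<in>I. f i x) = (\<Sum>i\<in>I. expct k p n (f i))"
proof (induction n arbitrary: f)
  case (Suc n)
  show ?case
    by (simp add: Suc sum_distrib_left) (rule sum.swap)
qed simp

lemma expct_nonneg:
  assumes "prob_weights k p" "\<And>x. x \<in> words k n \<Longrightarrow> 0 \<le> f x"
  shows "0 \<le> expct k p n f"
  using expct_mono[OF assms(1), of n "\<lambda>_. 0" f] assms expct_const[of k p n 0] by simp

lemma expct_le_const:
  assumes "prob_weights k p" "\<And>x. x \<in> words k n \<Longrightarrow> f x \<le> c"
  shows "expct k p n f \<le> c"
  using expct_mono[OF assms(1), of n f "\<lambda>_. c"] assms expct_const[of k p n c] by simp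

lemma expct_append:
  "expct k p (m + n) f = expct k p m (\<lambda>x. expct k p n (\<lambda>y. f (x @ y)))"
  by (induction m arbitrary: f) simp_all

lemma expct_swap:
  "expct k p m (\<lambda>x. expct l q n (\<lambda>y. f x y)) = expct l q n (\<lambda>y. expct k p m (\<lambda>x. f x y))"
  by (induction m arbitrary: f) (simp_all add: expct_sum expct_cmult)

text \<open>The image of a product measure under a letterwise map is the product of the image laws
  of a single letter; \<open>sum.group\<close> is the one-letter case.\<close>

lemma expct_map:
  assumes "\<And>a. a < k \<Longrightarrow> g a < l"
  shows "expct k p n (\<lambda>x. f (map g x)) = expct l (\<lambda>b. \<Sum>a | a < k \<and> g a = b. p a) n f"
proof (induction n arbitrary: f)
  case (Suc n)
  have "(\<Sum>a<k. p a * h (g a)) = (\<Sum>b<l. (\<Sum>a | a < k \<and> g a = b. p a) * h b)" for h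
  proof -
    have "(\<Sum>b<l. (\<Sum>a | a < k \<and> g a = b. p a) * h b)
        = (\<Sum>b<l. \<Sum>a | a \<in> {..<k} \<and> g a = b. p a * h (g a))"
      by (auto intro!: sum.cong simp: sum_distrib_right)
    also have "\<dots> = (\<Sum>a<k. p a * h (g a))"
      using assms by (intro sum.group) auto
    finally show ?thesis by simp
  qed
  note this[of "\<lambda>b. expct l (\<lambda>b. \<Sum>a | a < k \<and> g a = b. p a) n (\<lambda>x. f (b # x))"]
  moreover have "expct k p n (\<lambda>x. f (g a # map g x))
      = expct l (\<lambda>b. \<Sum>a | a < k \<and> g a = b. p a) n (\<lambda>x. f (g a # x))" for a
    using Suc[of "\<lambda>x. f (g a # x)"] .
  ultimately show ?case by simp
qed simp

lemma prob_weights_map: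
  assumes "prob_weights k p" "\<And>a. a < k \<Longrightarrow> g a < l"
  shows "prob_weights l (\<lambda>b. \<Sum>a | a < k \<and> g a = b. p a)"
proof -
  have "(\<Sum>b<l. \<Sum>a | a \<in> {..<k} \<and> g a = b. p a) = (\<Sum>a<k. p a)"
    using assms by (intro sum.group) auto
  with assms(1) show ?thesis
    by (auto simp: prob_weights_def intro!: sum_nonneg)
qed

lemma expct_unif: "expct k (unif k) n f = (\<Sum>x\<in>words k n. f x) / real k ^ n"
proof (induction n arbitrary: f)
  case (Suc n)
  have "(\<Sum>x\<in>words k (Suc n). f x) = (\<Sum>a<k. \<Sum>x\<in>words k n. f (a # x))"
    unfolding words_Suc
    by (subst sum.reindex) (auto simp: inj_on_def sum.cartesian_product case_prod_unfold)
  then show ?case by (simp add: Suc sum_divide_distrib mult.commute)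
qed simp

lemma expct_exists:
  assumes "prob_weights k p" "c \<le> expct k p n f"
  shows "\<exists>x\<in>words k n. c \<le> f x"
proof (rule ccontr)
  assume neg: "\<not> ?thesis"
  then have lt: "x \<in> words k n \<Longrightarrow> f x < c" for x by force
  have "words k n \<noteq> {}"
  proof -
    have "k > 0" using assms(1) by (cases "k = 0") (auto simp: prob_weights_def)
    then have "replicate n 0 \<in> words k n" by (auto simp: words_def)
    then show ?thesis by blast
  qed
  define M where "M = Max (f ` words k n)"
  have "M < c" unfolding M_def using lt \<open>words k n \<noteq> {}\<close> by auto
  moreover have "expct k p n f \<le> M"
    by (rule expct_le_const[OF assms(1)]) (simp add: M_def)
  ultimately show False using assms(2) by simp
qed

text \<open>The mean number of witnesses in \<open>W\<close> is at least \<open>c\<close>, so some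
  witness gets its share. This replaces a line or subspace that depends on \<open>x\<close> by a
  single one that serves many \<open>x\<close>.\<close>

lemma expct_pigeonhole:
  assumes "prob_weights k p" "finite W" "W \<noteq> {}"
    and "\<And>x. x \<in> words k n \<Longrightarrow> P x \<Longrightarrow> \<exists>w\<in>W. R w x"
    and "c \<le> expct k p n (\<lambda>x. of_bool (P x))"
  shows "\<exists>w\<in>W. c / real (card W) \<le> expct k p n (\<lambda>x. of_bool (R w x))"
proof (rule ccontr)
  assume "\<not> ?thesis"
  then have lt: "\<And>w. w \<in> W \<Longrightarrow> expct k p n (\<lambda>x. of_bool (R w x)) < c / real (card W)"
    by force
  have "c \<le> expct k p n (\<lambda>x. \<Sum>w\<in>W. of_bool (R w x))"
  proof (rule order.trans[OF assms(5)], rule expct_mono[OF assms(1)])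
    fix x assume "x \<in> words k n"
    show "of_bool (P x) \<le> (\<Sum>w\<in>W. of_bool (R w x) :: real)"
    proof (cases "P x")
      case True
      then obtain w where w: "w \<in> W" "R w x" using assms(4) \<open>x \<in> words k n\<close> by blast
      have "of_bool (R w x) \<le> (\<Sum>w\<in>W. of_bool (R w x) :: real)"
        by (rule member_le_sum) (use w assms(2) in auto)
      with w True show ?thesis by simp
    qed (simp add: sum_nonneg)
  qed
  also have "\<dots> < (\<Sum>w\<in>W. c / real (card W))"
    unfolding expct_sum by (rule sum_strict_mono) (use assms lt in auto)
  finally show False using assms(2,3) by simp
qed

text \<open>Pointwise, \<open>f\<close> is at most 1 where it reaches \<open>c / 2\<close>, and
  below \<open>c / 2\<close> elsewhere.\<close>

lemma expct_Markov:
  assumes "prob_weights k p" "\<And>x. x \<in> words k n \<Longrightarrow> f x \<le> 1" "c \<le> expct k p n f" "c > 0"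
  shows "c / 2 \<le> expct k p n (\<lambda>x. of_bool (c / 2 \<le> f x))"
proof -
  have "f x \<le> of_bool (c / 2 \<le> f x) + c / 2" if "x \<in> words k n" for x
    using assms(2)[OF that] assms(4) by (cases "c / 2 \<le> f x") auto
  then have "c \<le> expct k p n (\<lambda>x. of_bool (c / 2 \<le> f x) + c / 2)"
    using expct_mono[OF assms(1)] assms(3) by (meson order.trans)
  then show ?thesis by (simp add: expct_add expct_const[OF assms(1)])
qed

text \<open>The generating function of a binomial variable. At \<open>c = 1 / 2\<close> it bounds
  the probability of few letters \<open>k\<close>, at \<open>c = 0\<close> it is the probability of
  none.\<close>

lemma expct_count:
  assumes "prob_weights (Suc k) p"
  shows "expct (Suc k) p n (\<lambda>x. c ^ count_list x k) = (1 - p k + c * p k) ^ n"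
proof (induction n)
  case (Suc n)
  have *: "(\<Sum>a<k. p a) = 1 - p k" using assms by (simp add: prob_weights_def)
  have "expct (Suc k) p (Suc n) (\<lambda>x. c ^ count_list x k)
      = (\<Sum>a<k. p a * expct (Suc k) p n (\<lambda>x. c ^ count_list x k))
        + p k * (c * expct (Suc k) p n (\<lambda>x. c ^ count_list x k))"
    by (simp add: expct_cmult)
  also have "\<dots> = (1 - p k + c * p k) * expct (Suc k) p n (\<lambda>x. c ^ count_list x k)"
    unfolding sum_distrib_right[symmetric] * by (simp add: algebra_simps)
  finally show ?case by (simp add: Suc)
qed simp

section \<open>Combinatorial lines and subspaces\<close>

text \<open>
  A combinatorial line in words over the letters below \<open>k\<close> is a word over the letters below
  \<open>k + 1\<close> in which the letter \<open>k\<close> is the wildcard. Likewise, in a template of a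
  \<open>d\<close>-dimensional subspace the letters below \<open>k\<close> are constants and \<open>k + i\<close>, for
  \<open>i < d\<close>, is the \<open>i\<close>-th wildcard.
\<close>

definition repl :: "nat \<Rightarrow> nat \<Rightarrow> nat list \<Rightarrow> nat list" where
  "repl k j = map (\<lambda>a. if a = k then j else a)"

definition inst :: "nat \<Rightarrow> nat list \<Rightarrow> nat list \<Rightarrow> nat list" where
  "inst k V z = map (\<lambda>a. if a < k then a else z ! (a - k)) V"

definition subspaces :: "nat \<Rightarrow> nat \<Rightarrow> nat \<Rightarrow> nat list set" where
  "subspaces k d n = {V \<in> words (k + d) n. \<forall>i<d. k + i \<in> set V}"

definition has_line :: "nat \<Rightarrow> nat \<Rightarrow> nat list set \<Rightarrow> bool" where
  "has_line k n A \<longleftrightarrow> (\<exists>w\<in>words (Suc k) n. k \<in> set w \<and> (\<forall>j<k. repl k j w \<in> A))"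

definition dens :: "nat \<Rightarrow> nat \<Rightarrow> nat list set \<Rightarrow> real" where
  "dens k n A = expct k (unif k) n (\<lambda>x. of_bool (x \<in> A))"

definition DHJ :: "nat \<Rightarrow> bool" where
  "DHJ k \<longleftrightarrow> (\<forall>\<delta>>0. \<exists>N. \<forall>n\<ge>N. \<forall>A. \<delta> \<le> dens k n A \<longrightarrow> has_line k n A)"

lemma words_nonempty: "k \<ge> 1 \<Longrightarrow> words k n \<noteq> {}"
  using card_words[of k n] by fastforce

lemma repl_id: "x \<in> words k n \<Longrightarrow> repl k j x = x"
  unfolding repl_def words_def by (intro map_idI) auto

lemma repl_append: "repl k j (x @ y) = repl k j x @ repl k j y"
  by (simp add: repl_def)

lemma repl_words: "w \<in> words (Suc k) n \<Longrightarrow> j < k \<Longrightarrow> repl k j w \<in> words k n"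
  by (auto simp: repl_def words_def less_Suc_eq)

lemma inst_words:
  assumes "V \<in> words (k + d) n" "z \<in> words l d" "k \<le> l"
  shows "inst k V z \<in> words l n"
proof -
  have "z ! i < l" if "i < d" for i
    using assms(2) that by (auto simp: words_def subset_iff)
  then show ?thesis using assms unfolding inst_def by (intro map_words[OF assms(1)]) auto
qed

text \<open>Every wildcard occurs in \<open>V\<close>, so no entry of \<open>z\<close> is lost.
  Hence a line in the parameters keeps its wildcard when it is mapped into the subspace.\<close>

lemma inst_set:
  assumes "V \<in> subspaces k d n" "length z = d" "a \<in> set z"
  shows "a \<in> set (inst k V z)"
proof -
  obtain i where i: "i < d" "z ! i = a" using assms(2,3) by (auto simp: in_set_conv_nth)
  then have "k + i \<in> set V" using assms(1) by (auto simp: subspaces_def)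
  then have "(\<lambda>a. if a < k then a else z ! (a - k)) (k + i) \<in> set (inst k V z)"
    unfolding inst_def by (simp del: if_split) force
  with i show ?thesis by simp
qed

lemma map_inst:
  assumes "V \<in> words (k + d) n" "length z = d" "\<And>a. a < k \<Longrightarrow> g a = a"
  shows "map g (inst k V z) = inst k V (map g z)"
  using assms by (auto simp: inst_def words_def subset_iff)

lemma subspacesD: "V \<in> subspaces k d n \<Longrightarrow> V \<in> words (k + d) n"
  by (simp add: subspaces_def)

lemma has_line_inst:
  assumes "V \<in> subspaces k d n" "has_line k d {z. inst k V z \<in> A}"
  shows "has_line k n A"
proof -
  obtain w where w: "w \<in> words (Suc k) d" "k \<in> set w" "\<And>j. j < k \<Longrightarrow> inst k V (repl k j w) \<in> A"
    using assms(2) by (auto simp: has_line_def)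
  have "repl k j (inst k V w) = inst k V (repl k j w)" for j
    unfolding repl_def using w(1) subspacesD[OF assms(1)]
    by (intro map_inst) (auto simp: words_def)
  then show ?thesis unfolding has_line_def
    using w inst_set[OF assms(1), of w k] inst_words[OF subspacesD[OF assms(1)] w(1)]
    by (intro bexI[of _ "inst k V w"]) (auto simp: words_length)
qed

lemma has_line_append_left:
  assumes "x \<in> words k m" "has_line k n {y. x @ y \<in> A}"
  shows "has_line k (m + n) A"
proof -
  obtain w where w: "w \<in> words (Suc k) n" "k \<in> set w" "\<And>j. j < k \<Longrightarrow> x @ repl k j w \<in> A"
    using assms(2) by (auto simp: has_line_def)
  then show ?thesis unfolding has_line_def
    using assms(1) words_mono[of k "Suc k" m]
    by (intro bexI[of _ "x @ w"]) (auto simp: repl_append repl_id intro: words_append)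
qed

lemma has_line_append_right:
  assumes "y \<in> words k n" "has_line k m {x. x @ y \<in> A}"
  shows "has_line k (m + n) A"
proof -
  obtain w where w: "w \<in> words (Suc k) m" "k \<in> set w" "\<And>j. j < k \<Longrightarrow> repl k j w @ y \<in> A"
    using assms(2) by (auto simp: has_line_def)
  then show ?thesis unfolding has_line_def
    using assms(1) words_mono[of k "Suc k" n]
    by (intro bexI[of _ "w @ y"]) (auto simp: repl_append repl_id intro: words_append)
qed

lemma inst_inst:
  assumes "V \<in> words (k + d) n" "W \<in> words (k + e) d"
  shows "inst k (inst k V W) z = inst k V (inst k W z)"
  using assms by (auto simp: inst_def words_def subset_iff)

lemma inst_subspaces:
  assumes "V \<in> subspaces k d n" "W \<in> subspaces k e d"
  shows "inst k V W \<in> subspaces k e n"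
  using inst_words[OF subspacesD[OF assms(1)] subspacesD[OF assms(2)]] assms(2)
    inst_set[OF assms(1) words_length[OF subspacesD[OF assms(2)]]]
  by (auto simp: subspaces_def)

lemma inj_on_inst:
  assumes "V \<in> subspaces k d n"
  shows "inj_on (inst k V) (words l d)"
proof (rule inj_onI)
  fix z z' assume z: "z \<in> words l d" "z' \<in> words l d" "inst k V z = inst k V z'"
  show "z = z'"
  proof (rule nth_equalityI)
    show "length z = length z'" using z by (simp add: words_length)
    fix i assume "i < length z"
    then have "k + i \<in> set V" using assms z by (auto simp: subspaces_def words_length)
    with z(3) show "z ! i = z' ! i" unfolding inst_def map_eq_conv by fastforce
  qed
qed

lemma inst_id: "x \<in> words k n \<Longrightarrow> inst k x z = x"
  unfolding inst_def words_def by (intro map_idI) auto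

lemma inst_append: "inst k (V @ W) z = inst k V z @ inst k W z"
  by (simp add: inst_def)

lemma subspaces_append_left:
  assumes "x \<in> words k m" "V \<in> subspaces k d n"
  shows "x @ V \<in> subspaces k d (m + n)"
  using assms words_mono[of k "k + d" m] by (auto simp: subspaces_def intro: words_append)

lemma subspaces_append_right:
  assumes "y \<in> words k n" "V \<in> subspaces k d m"
  shows "V @ y \<in> subspaces k d (m + n)"
  using assms words_mono[of k "k + d" n] by (auto simp: subspaces_def intro: words_append)

section \<open>Densities of slices and the multidimensional density Hales-Jewett theorem\<close>

lemma dens_exists:
  assumes "k \<ge> 1" "0 < dens k n A"
  shows "\<exists>x\<in>words k n. x \<in> A"
proof -
  obtain x where "x \<in> words k n" "dens k n A \<le> of_bool (x \<in> A)"
    using expct_exists[OF prob_weights_unif[OF assms(1)]] unfolding dens_def by blast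
  with assms(2) show ?thesis by (cases "x \<in> A") auto
qed

lemma dens_append:
  "dens k (m + n) A = expct k (unif k) n (\<lambda>y. dens k m {x. x @ y \<in> A})"
  unfolding dens_def expct_append by (subst expct_swap) simp

lemma dens_append':
  "dens k (m + n) A = expct k (unif k) m (\<lambda>x. dens k n {y. x @ y \<in> A})"
  unfolding dens_def expct_append by simp

lemma dens_le_1: "k \<ge> 1 \<Longrightarrow> dens k n A \<le> 1"
  unfolding dens_def by (rule expct_le_const[OF prob_weights_unif]) auto

lemma dens_nonneg: "k \<ge> 1 \<Longrightarrow> 0 \<le> dens k n A"
  unfolding dens_def by (rule expct_nonneg[OF prob_weights_unif]) auto

text \<open>Induction on \<open>d\<close>. For many suffixes \<open>y\<close> the slice of
  \<open>A\<close> at \<open>y\<close> contains a line; by pigeonhole one line \<open>w\<close>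
  works for a set of \<open>y\<close> of density at least \<delta>'. A \<open>d\<close>-dimensional
  subspace of such \<open>y\<close>, put after \<open>w\<close>, has dimension
  \<open>d + 1\<close>.\<close>

lemma multidim_DHJ:
  assumes "DHJ k" "k \<ge> 1" "\<delta> > 0"
  shows "\<exists>N. \<forall>n\<ge>N. \<forall>A. \<delta> \<le> dens k n A \<longrightarrow>
           (\<exists>V\<in>subspaces k d n. \<forall>z\<in>words k d. inst k V z \<in> A)"
  using assms(3)
proof (induction d arbitrary: \<delta>)
  case 0
  have "\<exists>V\<in>subspaces k 0 n. \<forall>z\<in>words k 0. inst k V z \<in> A" if "\<delta> \<le> dens k n A" for n A
  proof -
    have "0 < dens k n A" using that 0 by linarith
    then obtain x where "x \<in> words k n" "x \<in> A"
      using dens_exists[OF assms(2)] by blast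
    then show ?thesis by (intro bexI[of _ x]) (auto simp: subspaces_def inst_id)
  qed
  then show ?case by blast
next
  case (Suc d)
  let ?u = "unif k"
  note u = prob_weights_unif[OF assms(2)]
  have "\<delta> / 2 > 0" using Suc.prems by simp
  then obtain N1 where "\<forall>n\<ge>N1. \<forall>A. \<delta> / 2 \<le> dens k n A \<longrightarrow> has_line k n A"
    using assms(1) unfolding DHJ_def by blast
  then have N1: "\<delta> / 2 \<le> dens k N1 A \<Longrightarrow> has_line k N1 A" for A by blast
  define \<delta>' where "\<delta>' = \<delta> / 2 / real (card (words (Suc k) N1))"
  have card0: "0 < card (words (Suc k) N1)" by (simp add: card_words)
  have "\<delta>' > 0" using Suc.prems card0 by (simp add: \<delta>'_def)
  from Suc.IH[OF this] obtain N2 where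
    N2: "\<And>n A. n \<ge> N2 \<Longrightarrow> \<delta>' \<le> dens k n A \<Longrightarrow> \<exists>V\<in>subspaces k d n. \<forall>z\<in>words k d. inst k V z \<in> A"
    by blast
  have "\<exists>V\<in>subspaces k (Suc d) n. \<forall>z\<in>words k (Suc d). inst k V z \<in> A"
    if n: "n \<ge> N1 + N2" and A: "\<delta> \<le> dens k n A" for n A
  proof -
    define n2 where "n2 = n - N1"
    have n2: "n = N1 + n2" "n2 \<ge> N2" using n by (auto simp: n2_def)
    define R where "R w y \<longleftrightarrow> k \<in> set w \<and> (\<forall>j<k. repl k j w @ y \<in> A)" for w y
    have "\<delta> / 2 \<le> expct k ?u n2 (\<lambda>y. of_bool (\<delta> / 2 \<le> dens k N1 {x. x @ y \<in> A}))"
      using A Suc.prems dens_le_1[OF assms(2)] unfolding n2(1) dens_append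
      by (intro expct_Markov[OF u]) auto
    moreover have "\<exists>w\<in>words (Suc k) N1. R w y" if "\<delta> / 2 \<le> dens k N1 {x. x @ y \<in> A}" for y
      using N1[OF that] by (auto simp: R_def has_line_def)
    ultimately have "\<exists>w\<in>words (Suc k) N1. \<delta>' \<le> expct k ?u n2 (\<lambda>y. of_bool (R w y))"
      unfolding \<delta>'_def using card0
      by (intro expct_pigeonhole[OF u]) (auto simp: card_gt_0_iff simp del: card_words)
    then obtain w where w: "w \<in> words (Suc k) N1" "\<delta>' \<le> dens k n2 {y. R w y}"
      by (auto simp: dens_def)
    from N2[OF n2(2) w(2)] obtain V where
      V: "V \<in> subspaces k d n2" "\<And>z. z \<in> words k d \<Longrightarrow> R w (inst k V z)" by auto
    have kw: "k \<in> set w" using V(2) words_nonempty[OF assms(2), of d] by (auto simp: R_def)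
    \<comment> \<open>The wildcard of \<open>w\<close> becomes the last one, \<open>k + d\<close>,
      so that those of \<open>V\<close> keep their numbers.\<close>
    define V' where "V' = map (\<lambda>a. if a = k then k + d else a) w @ V"
    have "V' \<in> subspaces k (Suc d) n"
      using w(1) V(1) kw unfolding V'_def subspaces_def n2(1)
      by (auto simp: words_def less_Suc_eq subset_iff)
    moreover have "inst k V' z \<in> A" if z: "z \<in> words k (Suc d)" for z
    proof -
      have zd: "z ! d < k" using z by (auto simp: words_def subset_iff)
      have "take d z \<in> words k d" using z by (auto simp: words_def dest: in_set_takeD)
      then have "R w (inst k V (take d z))" by (rule V(2))
      moreover have "inst k V (take d z) = inst k V z"
        using V(1) by (auto simp: inst_def subspaces_def words_def subset_iff)
      moreover have "inst k (map (\<lambda>a. if a = k then k + d else a) w) z = repl k (z ! d) w"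
        using w(1) by (auto simp: inst_def repl_def words_def less_Suc_eq subset_iff)
      ultimately show ?thesis using zd by (simp add: V'_def inst_append R_def)
    qed
    ultimately show ?thesis by blast
  qed
  then show ?case by blast
qed

section \<open>Random coordinate subspaces\<close>

text \<open>
  The letter \<open>k\<close> in \<open>T\<close> marks the free coordinates, which are filled
  from left to right with the entries of \<open>z\<close>.
\<close>

primrec fill :: "nat \<Rightarrow> nat list \<Rightarrow> nat list \<Rightarrow> nat list" where
  "fill k [] z = []"
| "fill k (a # T) z = (if a = k then hd z # fill k T (tl z) else a # fill k T z)"

lemma map_fill:
  assumes "T \<in> words (Suc k) n" "length z = count_list T k" "\<And>a. a < k \<Longrightarrow> g a = a"
  shows "map g (fill k T z) = fill k T (map g z)"
  using assms(1,2)
proof (induction T arbitrary: n z)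
  case (Cons a T)
  then obtain m where "n = Suc m" "a \<le> k" "T \<in> words (Suc k) m" by (cases n) auto
  with Cons assms(3) show ?case by (cases z) (auto simp: le_less)
qed simp

lemma fill_words:
  assumes "T \<in> words (Suc k) n" "z \<in> words l (count_list T k)" "k \<le> l"
  shows "fill k T z \<in> words l n"
  using assms(1,2)
proof (induction T arbitrary: n z)
  case Nil
  then show ?case by (auto simp: words_def)
next
  case (Cons a T)
  then obtain m where m: "n = Suc m" "a \<le> k" "T \<in> words (Suc k) m" by (cases n) (auto simp: words_def)
  with Cons assms(3) show ?case by (cases z) (auto dest: words_length)
qed

lemma set_fill:
  assumes "length z = count_list T k"
  shows "set z \<subseteq> set (fill k T z)"
  using assms
proof (induction T arbitrary: z)
  case (Cons a T)
  show ?case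
  proof (cases "a = k")
    case True
    with Cons show ?thesis by (cases z) auto
  next
    case False
    with Cons show ?thesis by auto
  qed
qed simp

lemma has_line_fill:
  assumes "T \<in> words (Suc k) n" "has_line k (count_list T k) {z. fill k T z \<in> A}"
  shows "has_line k n A"
proof -
  obtain w where w: "w \<in> words (Suc k) (count_list T k)" "k \<in> set w"
    "\<And>j. j < k \<Longrightarrow> fill k T (repl k j w) \<in> A"
    using assms(2) by (auto simp: has_line_def)
  have "repl k j (fill k T w) = fill k T (repl k j w)" for j
    unfolding repl_def using words_length[OF w(1)] by (intro map_fill[OF assms(1)]) auto
  then show ?thesis unfolding has_line_def
    using w set_fill[of w T k] fill_words[OF assms(1) w(1)] words_length[OF w(1)]
    by (intro bexI[of _ "fill k T w"]) auto
qed

lemma fill_subspaces: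
  assumes "T \<in> words (Suc k) n" "V \<in> subspaces k d (count_list T k)"
  shows "fill k T V \<in> subspaces k d n"
  using set_fill[OF words_length[OF subspacesD[OF assms(2)]]] assms(2)
    fill_words[OF assms(1) subspacesD[OF assms(2)]] by (auto simp: subspaces_def)

lemma inst_fill:
  assumes "T \<in> words (Suc k) n" "V \<in> subspaces k d (count_list T k)"
  shows "inst k (fill k T V) z = fill k T (inst k V z)"
  unfolding inst_def using words_length[OF subspacesD[OF assms(2)]]
  by (intro map_fill[OF assms(1)]) auto

text \<open>
  A product measure whose atoms are bounded below is a mixture of uniform measures on
  coordinate subspaces, almost all of which have large dimension. So a set of large
  product measure has large uniform density on some of them.
\<close>

lemma expct_fill:
  assumes "k \<ge> 1" "\<And>a. a < k \<Longrightarrow> p a = \<sigma> a + \<sigma> k / real k"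
  shows "expct k p n f = expct (Suc k) \<sigma> n
           (\<lambda>T. expct k (unif k) (count_list T k) (\<lambda>z. f (fill k T z)))"
proof (induction n arbitrary: f)
  case (Suc n)
  have "(\<Sum>a<k. p a * h a) = (\<Sum>a<k. \<sigma> a * h a) + \<sigma> k * (\<Sum>a<k. 1 / real k * h a)" for h
    using assms(2) by (simp add: sum_distrib_left sum.distrib[symmetric] algebra_simps)
  then show ?case
    by (simp add: Suc expct_sum expct_cmult del: times_divide_eq_left)
qed simp

lemma exists_fill:
  assumes "k \<ge> 1" "\<eta> > 0" "\<epsilon> > 0"
  shows "\<exists>N. \<forall>n\<ge>N. \<forall>p f c. prob_weights k p \<longrightarrow> (\<forall>a<k. \<eta> \<le> p a) \<longrightarrow>
    (\<forall>x\<in>words k n. f x \<le> 1) \<longrightarrow> 0 \<le> c \<longrightarrow> c \<le> expct k p n f \<longrightarrow>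
    (\<exists>T\<in>words (Suc k) n. M \<le> count_list T k \<and>
      c - \<epsilon> \<le> expct k (unif k) (count_list T k) (\<lambda>z. f (fill k T z)))"
proof (cases "real k * \<eta> \<le> 1")
  \<comment> \<open>Vacuous: \<open>k\<close> weights of at least \<eta> would add up to more than
    1.\<close>
  case False
  have "\<not> (prob_weights k p \<and> (\<forall>a<k. \<eta> \<le> p a))" for p
  proof
    assume p: "prob_weights k p \<and> (\<forall>a<k. \<eta> \<le> p a)"
    then have "(\<Sum>a<k. \<eta>) \<le> (\<Sum>a<k. p a)" by (intro sum_mono) auto
    with p False show False by (simp add: prob_weights_def)
  qed
  then show ?thesis by blast
next
  case True
  \<comment> \<open>A coordinate will be free with probability \<open>real k * \<eta>\<close>;
    \<open>b\<close> is the mean of the factor that is 1/2 on a free coordinate and 1 on a fixed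
    one.\<close>
  define b where "b = 1 - real k * \<eta> / 2"
  have b: "0 \<le> b" "b < 1" using True assms by (auto simp: b_def)
  have "(\<lambda>n. (1 + \<epsilon>) * 2 ^ M * b ^ n) \<longlonglongrightarrow> (1 + \<epsilon>) * 2 ^ M * 0"
    by (intro tendsto_intros LIMSEQ_realpow_zero b)
  then have "eventually (\<lambda>n. (1 + \<epsilon>) * 2 ^ M * b ^ n < \<epsilon>) sequentially"
    using assms(3) by (intro order_tendstoD) auto
  then obtain N where N: "\<And>n. n \<ge> N \<Longrightarrow> (1 + \<epsilon>) * 2 ^ M * b ^ n < \<epsilon>"
    by (auto simp: eventually_sequentially)
  have "\<exists>T\<in>words (Suc k) n. M \<le> count_list T k \<and>
      c - \<epsilon> \<le> expct k (unif k) (count_list T k) (\<lambda>z. f (fill k T z))"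
    if "n \<ge> N" and p: "prob_weights k p" "\<And>a. a < k \<Longrightarrow> \<eta> \<le> p a" and
      f: "\<And>x. x \<in> words k n \<Longrightarrow> f x \<le> 1" and c: "0 \<le> c" "c \<le> expct k p n f" for n p f c
  proof -
    \<comment> \<open>Mass \<eta> is taken from each letter and the total is given to the mark
      \<open>k\<close> of a free coordinate. Filling that coordinate uniformly returns \<eta> to
      each letter.\<close>
    define \<sigma> where "\<sigma> a = (if a = k then real k * \<eta> else p a - \<eta>)" for a
    have \<sigma>: "prob_weights (Suc k) \<sigma>"
      using p assms(2) by (auto simp: prob_weights_def \<sigma>_def sum_subtractf)
    define g where "g T = expct k (unif k) (count_list T k) (\<lambda>z. f (fill k T z))" for T
    have g1: "g T \<le> 1" if "T \<in> words (Suc k) n" for T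
      unfolding g_def
      by (rule expct_le_const[OF prob_weights_unif[OF assms(1)]]) (use f fill_words[OF that] in auto)
    have "c \<le> expct (Suc k) \<sigma> n g"
      unfolding g_def using c(2) assms(1) expct_fill[OF assms(1), of p \<sigma> n f]
      by (simp add: \<sigma>_def)
    moreover have "expct (Suc k) \<sigma> n (\<lambda>T. of_bool (count_list T k < M)) \<le> 2 ^ M * b ^ n"
    proof -
      have "expct (Suc k) \<sigma> n (\<lambda>T. of_bool (count_list T k < M))
          \<le> expct (Suc k) \<sigma> n (\<lambda>T. 2 ^ M * (1 / 2) ^ count_list T k)"
      proof (rule expct_mono[OF \<sigma>])
        fix T
        have "1 \<le> 2 ^ M * (1 / 2 :: real) ^ j" if "j < M" for j
        proof -
          have "(2::real) ^ j \<le> 2 ^ M" using that by (intro power_increasing) auto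
          then show ?thesis by (simp add: power_one_over field_simps)
        qed
        then show "of_bool (count_list T k < M) \<le> 2 ^ M * (1 / 2 :: real) ^ count_list T k"
          by (cases "count_list T k < M") auto
      qed
      also have "\<dots> = 2 ^ M * b ^ n"
        unfolding expct_cmult expct_count[OF \<sigma>] by (simp add: \<sigma>_def b_def mult.commute)
      finally show ?thesis .
    qed
    then have "(1 + \<epsilon>) * expct (Suc k) \<sigma> n (\<lambda>T. of_bool (count_list T k < M)) < \<epsilon>"
      using N[OF \<open>n \<ge> N\<close>] assms(3)
      by (smt (verit, best) mult.assoc mult_left_mono)
    \<comment> \<open>As \<open>g\<close> is at most 1 and \<open>c\<close> is nonnegative, the
      penalty \<open>1 + \<epsilon>\<close> keeps every \<open>T\<close> with fewer than
      \<open>M\<close> free coordinates from exceeding \<open>c - \<epsilon>\<close>.\<close>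
    ultimately have "c - \<epsilon> < expct (Suc k) \<sigma> n (\<lambda>T. g T - (1 + \<epsilon>) * of_bool (count_list T k < M))"
      by (simp add: expct_diff expct_cmult)
    with expct_exists[OF \<sigma> order.refl] obtain T where
      T: "T \<in> words (Suc k) n" "c - \<epsilon> < g T - (1 + \<epsilon>) * of_bool (count_list T k < M)"
      by (meson less_le_trans)
    have "M \<le> count_list T k"
    proof (rule ccontr)
      assume "\<not> M \<le> count_list T k"
      with T(2) g1[OF T(1)] c(1) show False by simp
    qed
    with T show ?thesis unfolding g_def by (intro bexI[of _ T]) auto
  qed
  then show ?thesis by blast
qed

text \<open>Needed because identifying two letters turns the uniform measure into a nonuniform one.
  The subspace is found inside a coordinate subspace on which \<open>A\<close> has uniform density
  at least \<open>\<delta> / 2\<close>.\<close>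

lemma multidim_DHJ_weighted:
  assumes "DHJ k" "k \<ge> 1" "\<delta> > 0" "\<eta> > 0"
  shows "\<exists>N. \<forall>n\<ge>N. \<forall>p A. prob_weights k p \<longrightarrow> (\<forall>a<k. \<eta> \<le> p a) \<longrightarrow>
           \<delta> \<le> expct k p n (\<lambda>x. of_bool (x \<in> A)) \<longrightarrow>
           (\<exists>V\<in>subspaces k d n. \<forall>z\<in>words k d. inst k V z \<in> A)"
proof -
  have d2: "\<delta> / 2 > 0" using assms by simp
  obtain M where M: "\<And>n A. n \<ge> M \<Longrightarrow> \<delta> / 2 \<le> dens k n A \<Longrightarrow>
      \<exists>V\<in>subspaces k d n. \<forall>z\<in>words k d. inst k V z \<in> A"
    using multidim_DHJ[OF assms(1,2) d2] by blast
  obtain N where N: "\<And>n p f c. n \<ge> N \<Longrightarrow> prob_weights k p \<Longrightarrow> (\<forall>a<k. \<eta> \<le> p a) \<Longrightarrow>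
    (\<forall>x\<in>words k n. f x \<le> 1) \<Longrightarrow> 0 \<le> c \<Longrightarrow> c \<le> expct k p n f \<Longrightarrow>
    (\<exists>T\<in>words (Suc k) n. M \<le> count_list T k \<and>
      c - \<delta> / 2 \<le> expct k (unif k) (count_list T k) (\<lambda>z. f (fill k T z)))"
    using exists_fill[OF assms(2,4) d2, of M] by blast
  have "\<exists>V\<in>subspaces k d n. \<forall>z\<in>words k d. inst k V z \<in> A"
    if h: "n \<ge> N" "prob_weights k p" "\<forall>a<k. \<eta> \<le> p a" "\<delta> \<le> expct k p n (\<lambda>x. of_bool (x \<in> A))" for n p A
  proof -
    obtain T where T: "T \<in> words (Suc k) n" "M \<le> count_list T k"
      "\<delta> / 2 \<le> dens k (count_list T k) {z. fill k T z \<in> A}"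
      using N[OF h(1-3) _ _ h(4)] assms(3) by (auto simp: dens_def)
    from M[OF T(2,3)] obtain V where V: "V \<in> subspaces k d (count_list T k)"
      "\<forall>z\<in>words k d. fill k T (inst k V z) \<in> A" by auto
    then show ?thesis
      by (intro bexI[of _ "fill k T V"]) (auto simp: inst_fill[OF T(1)] fill_subspaces[OF T(1)])
  qed
  then show ?thesis by blast
qed

section \<open>Insensitive sets\<close>

text \<open>Exchanging letters \<open>i\<close> and \<open>k\<close> anywhere in a word does not
  affect membership: words that differ only in this way have the same collapse
  \<open>repl k i x\<close>, so comparison with the collapse is enough.\<close>

definition insensitive :: "nat \<Rightarrow> nat \<Rightarrow> nat \<Rightarrow> nat list set \<Rightarrow> bool" where
  "insensitive k i n C \<longleftrightarrow> (\<forall>x\<in>words (Suc k) n. x \<in> C \<longleftrightarrow> repl k i x \<in> C)"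

lemma repl_in_words: "x \<in> words (Suc k) n \<Longrightarrow> i < k \<Longrightarrow> repl k i x \<in> words (Suc k) n"
  using repl_words words_mono[of k "Suc k" n] by auto

text \<open>The common form of all restrictions to slices and subspaces. The condition on
  \<open>h\<close> says that turning \<open>k\<close> into \<open>i\<close> in \<open>z\<close>
  changes \<open>h z\<close> only by exchanges of \<open>i\<close> and \<open>k\<close>.\<close>

lemma insensitive_vimage:
  assumes "insensitive k i n C" "i < k"
    and "\<And>z. z \<in> words (Suc k) m \<Longrightarrow> h z \<in> words (Suc k) n"
    and "\<And>z. z \<in> words (Suc k) m \<Longrightarrow> repl k i (h z) = repl k i (h (repl k i z))"
  shows "insensitive k i m {z. h z \<in> C}"
  using assms repl_in_words[OF _ assms(2)] unfolding insensitive_def by auto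

lemma repl_repl: "i \<noteq> k \<Longrightarrow> repl k i (repl k i x) = repl k i x"
  by (auto simp: repl_def)

lemma insensitive_slice_left:
  assumes "insensitive k i (m + n) C" "i < k" "x \<in> words (Suc k) m"
  shows "insensitive k i n {y. x @ y \<in> C}"
  by (rule insensitive_vimage[OF assms(1,2)])
     (use assms in \<open>auto simp: repl_append repl_repl intro: words_append\<close>)

lemma insensitive_slice_right:
  assumes "insensitive k i (m + n) C" "i < k" "y \<in> words (Suc k) n"
  shows "insensitive k i m {x. x @ y \<in> C}"
  by (rule insensitive_vimage[OF assms(1,2)])
     (use assms in \<open>auto simp: repl_append repl_repl intro: words_append\<close>)

lemma insensitive_inst:
  assumes "insensitive k i n C" "i < k" "V \<in> words (Suc k + d) n"
  shows "insensitive k i d {z. inst (Suc k) V z \<in> C}"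
proof (rule insensitive_vimage[OF assms(1,2)])
  fix z assume z: "z \<in> words (Suc k) d"
  show "inst (Suc k) V z \<in> words (Suc k) n" by (rule inst_words[OF assms(3) z]) simp
  show "repl k i (inst (Suc k) V z) = repl k i (inst (Suc k) V (repl k i z))"
    using z assms(2,3) by (auto simp: repl_def inst_def words_def subset_iff)
qed

lemma repl_fill_cong:
  assumes "length z = count_list T l" "length z' = count_list T l" "repl k i z = repl k i z'"
  shows "repl k i (fill l T z) = repl k i (fill l T z')"
  using assms
proof (induction T arbitrary: z z')
  case (Cons a T)
  show ?case
  proof (cases "a = l")
    case True
    with Cons.prems obtain b y b' y' where "z = b # y" "z' = b' # y'" by (cases z; cases z') auto
    with Cons.prems True Cons.IH[of y y'] show ?thesis by (simp add: repl_def)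
  next
    case False
    with Cons.prems Cons.IH[of z z'] show ?thesis by (simp add: repl_def)
  qed
qed simp

lemma insensitive_fill:
  assumes "insensitive k i n C" "i < k" "T \<in> words (Suc (Suc k)) n"
  shows "insensitive k i (count_list T (Suc k)) {z. fill (Suc k) T z \<in> C}"
proof (rule insensitive_vimage[OF assms(1,2)])
  fix z assume z: "z \<in> words (Suc k) (count_list T (Suc k))"
  show "fill (Suc k) T z \<in> words (Suc k) n" by (rule fill_words[OF assms(3) z]) simp
  show "repl k i (fill (Suc k) T z) = repl k i (fill (Suc k) T (repl k i z))"
    using words_length[OF z] assms(2) by (intro repl_fill_cong) (auto simp: repl_repl repl_def)
qed

text \<open>Collapsing \<open>k\<close> to \<open>i\<close> reduces the question to \<open>k\<close>
  letters: \<open>C\<close> is the preimage of its own trace on \<open>k\<close>-letter words,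
  measured by the image law \<open>p\<close>, whose atoms are at least \<open>1 / (k + 1)\<close>.
  Insensitivity lets the subspace found there take the letter \<open>k\<close> as well.\<close>

lemma insensitive_subspace:
  assumes "DHJ k" "k \<ge> 1" "i < k" "\<kappa> > 0"
  shows "\<exists>N. \<forall>n\<ge>N. \<forall>C. insensitive k i n C \<longrightarrow> \<kappa> \<le> dens (Suc k) n C \<longrightarrow>
           (\<exists>V\<in>subspaces (Suc k) d n. \<forall>z\<in>words (Suc k) d. inst (Suc k) V z \<in> C)"
proof -
  define \<eta> where "\<eta> = 1 / real (Suc k)"
  define g where "g a = (if a = k then i else a)" for a
  define p where "p b = (\<Sum>a | a < Suc k \<and> g a = b. unif (Suc k) a)" for b
  have g: "g a < k" if "a < Suc k" for a using that assms(3) by (auto simp: g_def)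
  have "\<eta> > 0" by (simp add: \<eta>_def)
  from multidim_DHJ_weighted[OF assms(1,2,4) this] obtain N where
    N: "\<And>n p A. n \<ge> N \<Longrightarrow> prob_weights k p \<Longrightarrow> (\<forall>a<k. \<eta> \<le> p a) \<Longrightarrow>
           \<kappa> \<le> expct k p n (\<lambda>x. of_bool (x \<in> A)) \<Longrightarrow>
           (\<exists>V\<in>subspaces k d n. \<forall>z\<in>words k d. inst k V z \<in> A)"
    by blast
  have p: "prob_weights k p"
    unfolding p_def by (rule prob_weights_map[OF prob_weights_unif]) (use g in auto)
  have "\<eta> \<le> p b" if "b < k" for b
    unfolding p_def \<eta>_def
    by (rule member_le_sum[of b _ "unif (Suc k)"]) (use that in \<open>auto simp: g_def\<close>)
  have "\<exists>V\<in>subspaces (Suc k) d n. \<forall>z\<in>words (Suc k) d. inst (Suc k) V z \<in> C"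
    if n: "n \<ge> N" and C: "insensitive k i n C" and dC: "\<kappa> \<le> dens (Suc k) n C" for n C
  proof -
    have "dens (Suc k) n C = expct (Suc k) (unif (Suc k)) n (\<lambda>x. of_bool (map g x \<in> C))"
      unfolding dens_def using C
      by (intro expct_cong) (auto simp: insensitive_def repl_def g_def[abs_def])
    also have "\<dots> = expct k p n (\<lambda>x. of_bool (x \<in> C))"
      using expct_map[of "Suc k" g k "unif (Suc k)" n "\<lambda>x. of_bool (x \<in> C)"] g
      by (simp add: p_def[abs_def])
    finally obtain V where V: "V \<in> subspaces k d n" "\<And>z. z \<in> words k d \<Longrightarrow> inst k V z \<in> C"
      using N[OF n p _, of C] dC \<open>\<And>b. b < k \<Longrightarrow> \<eta> \<le> p b\<close> by auto
    \<comment> \<open>Over \<open>k + 1\<close> letters \<open>k\<close> is a constant, so all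
      wildcards move up by one.\<close>
    define V' where "V' = map (\<lambda>a. if a < k then a else Suc a) V"
    have "V' \<in> subspaces (Suc k) d n"
      unfolding subspaces_def
    proof (intro CollectI conjI allI impI)
      show "V' \<in> words (Suc k + d) n"
        using V(1) by (auto simp: V'_def subspaces_def words_def)
      fix j assume "j < d"
      then have "k + j \<in> set V" using V(1) by (auto simp: subspaces_def)
      then show "Suc k + j \<in> set V'" unfolding V'_def by (auto intro!: image_eqI[of _ _ "k + j"])
    qed
    moreover have "inst (Suc k) V' z \<in> C" if z: "z \<in> words (Suc k) d" for z
    proof -
      have "repl k i (inst (Suc k) V' z) = inst k V (repl k i z)"
        using z V(1) by (auto simp: repl_def inst_def V'_def words_def subspaces_def subset_iff)
      moreover have "inst (Suc k) V' z \<in> words (Suc k) n"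
        using inst_words[OF subspacesD[OF \<open>V' \<in> _\<close>] z] by simp
      ultimately show ?thesis
        using C V(2)[OF repl_words[OF z assms(3)]] by (simp add: insensitive_def)
    qed
    ultimately show ?thesis by blast
  qed
  then show ?thesis by blast
qed

text \<open>
  An insensitive set is, up to small density, a disjoint union of \<open>d\<close>-dimensional subspaces.
  This is stated dually: a function with nonpositive mean on all these subspaces has almost
  nonpositive integral over the set. The subspaces are removed greedily, each step gaining a
  fixed proportion \<open>\<rho>\<close> of the density.
\<close>

definition nonpos_on_subspaces ::
    "nat \<Rightarrow> nat \<Rightarrow> nat \<Rightarrow> nat list set \<Rightarrow> (nat list \<Rightarrow> real) \<Rightarrow> bool" where
  "nonpos_on_subspaces k d n C f \<longleftrightarrow>
     (\<forall>V\<in>subspaces k d n. (\<forall>z\<in>words k d. inst k V z \<in> C) \<longrightarrow>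
        expct k (unif k) d (\<lambda>z. f (inst k V z)) \<le> 0)"

lemma insensitive_expct_le_aux:
  assumes "DHJ k" "k \<ge> 1" "i < k" "0 < \<kappa>" "\<kappa> \<le> 1"
  shows "\<exists>\<rho>. 0 < \<rho> \<and> \<rho> \<le> 1 \<and> (\<forall>s. \<exists>M. \<forall>n\<ge>M. \<forall>C f. insensitive k i n C \<longrightarrow>
      (\<forall>x\<in>words (Suc k) n. f x \<le> 1) \<longrightarrow>
      nonpos_on_subspaces (Suc k) d n C f \<longrightarrow>
      expct (Suc k) (unif (Suc k)) n (\<lambda>x. f x * of_bool (x \<in> C))
        \<le> \<kappa> + (1 - \<rho>) ^ s * dens (Suc k) n C)"
proof -
  let ?K = "Suc k"
  let ?E = "expct ?K (unif ?K)"
  have u: "prob_weights ?K (unif ?K)" by (rule prob_weights_unif) simp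
  have K1: "1 \<le> ?K" by simp
  have "\<kappa> / 2 > 0" using assms(4) by simp
  from insensitive_subspace[OF assms(1-3) this, of d] obtain N where
    N: "\<And>C. insensitive k i N C \<Longrightarrow> \<kappa> / 2 \<le> dens ?K N C \<Longrightarrow>
        \<exists>V\<in>subspaces ?K d N. \<forall>z\<in>words ?K d. inst ?K V z \<in> C" by blast
  define cw where "cw = card (words (?K + d) N)"
  have cw: "0 < cw" by (simp add: cw_def card_words)
  \<comment> \<open>The suffixes that share one template have density at least \<rho>0 by Markov and
    pigeonhole; the subspace itself has density at least \<open>1 / real ?K ^ N\<close> among the
    prefixes. The product \<rho> is the density removed in one round.\<close>
  define \<rho>0 where "\<rho>0 = \<kappa> / 2 / real cw"
  define \<rho> where "\<rho> = \<rho>0 / real ?K ^ N"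
  have \<rho>0: "0 < \<rho>0" "\<rho>0 \<le> 1"
  proof -
    show "0 < \<rho>0" using cw assms(4) by (simp add: \<rho>0_def)
    have "\<kappa> / 2 \<le> real cw" using cw assms(5) by linarith
    then show "\<rho>0 \<le> 1" using cw by (simp add: \<rho>0_def field_simps)
  qed
  have KN: "1 \<le> real ?K ^ N" by (rule one_le_power) simp
  have "\<rho>0 \<le> real ?K ^ N" using \<rho>0 KN by linarith
  then have \<rho>: "0 < \<rho>" "\<rho> \<le> 1"
    using \<rho>0 by (auto simp: \<rho>_def divide_le_eq simp del: of_nat_Suc)
  have "\<exists>M. \<forall>n\<ge>M. \<forall>C f. insensitive k i n C \<longrightarrow>
      (\<forall>x\<in>words ?K n. f x \<le> 1) \<longrightarrow>
      nonpos_on_subspaces ?K d n C f \<longrightarrow>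
      ?E n (\<lambda>x. f x * of_bool (x \<in> C)) \<le> \<kappa> + (1 - \<rho>) ^ s * dens ?K n C" for s
  proof (induction s)
    case 0
    have "?E n (\<lambda>x. f x * of_bool (x \<in> C)) \<le> \<kappa> + (1 - \<rho>) ^ 0 * dens ?K n C"
      if f: "\<forall>x\<in>words ?K n. f x \<le> 1" for n C f
    proof -
      have "?E n (\<lambda>x. f x * of_bool (x \<in> C)) \<le> dens ?K n C"
        unfolding dens_def by (rule expct_mono[OF u]) (use f in \<open>auto simp: of_bool_def\<close>)
      then show ?thesis using assms(4) by simp
    qed
    then show ?case by blast
  next
    case (Suc s)
    then obtain M where M: "\<And>n C f. n \<ge> M \<Longrightarrow> insensitive k i n C \<Longrightarrow>
      \<forall>x\<in>words ?K n. f x \<le> 1 \<Longrightarrow> nonpos_on_subspaces ?K d n C f \<Longrightarrow>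
      ?E n (\<lambda>x. f x * of_bool (x \<in> C)) \<le> \<kappa> + (1 - \<rho>) ^ s * dens ?K n C"
      by blast
    have "?E n (\<lambda>x. f x * of_bool (x \<in> C)) \<le> \<kappa> + (1 - \<rho>) ^ Suc s * dens ?K n C"
      if n: "n \<ge> N + M" and C: "insensitive k i n C" and f: "\<forall>x\<in>words ?K n. f x \<le> 1"
        and sub: "nonpos_on_subspaces ?K d n C f" for n C f
    proof (cases "dens ?K n C \<le> \<kappa>")
      case True
      have "?E n (\<lambda>x. f x * of_bool (x \<in> C)) \<le> dens ?K n C"
        unfolding dens_def by (rule expct_mono[OF u]) (use f in \<open>auto simp: of_bool_def\<close>)
      moreover have "0 \<le> (1 - \<rho>) ^ Suc s * dens ?K n C"
        using \<rho> dens_nonneg[OF K1] by (intro mult_nonneg_nonneg zero_le_power) auto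
      ultimately show ?thesis using True by linarith
    next
      case False
      define n' where "n' = n - N"
      have n': "n = N + n'" "n' \<ge> M" using n by (auto simp: n'_def)
      note C' = C[unfolded n'(1)]
      define R where "R V y \<longleftrightarrow> V \<in> subspaces ?K d N \<and> (\<forall>z\<in>words ?K d. inst ?K V z @ y \<in> C)" for V y
      have "\<kappa> / 2 \<le> ?E n' (\<lambda>y. of_bool (\<kappa> / 2 \<le> dens ?K N {x. x @ y \<in> C}))"
        using False assms(4) dens_le_1[OF K1] unfolding n'(1) dens_append
        by (intro expct_Markov[OF u]) auto
      moreover have "\<exists>V\<in>words (?K + d) N. R V y"
        if "y \<in> words ?K n'" "\<kappa> / 2 \<le> dens ?K N {x. x @ y \<in> C}" for y
        using N[OF insensitive_slice_right[OF C' assms(3) that(1)] that(2)]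
        by (auto simp: R_def subspaces_def)
      ultimately have "\<exists>V\<in>words (?K + d) N. \<rho>0 \<le> ?E n' (\<lambda>y. of_bool (R V y))"
        unfolding \<rho>0_def cw_def using cw
        by (intro expct_pigeonhole[OF u]) (auto simp: card_gt_0_iff cw_def)
      then obtain V where V: "\<rho>0 \<le> ?E n' (\<lambda>y. of_bool (R V y))" by blast
      have VS: "V \<in> subspaces ?K d N"
      proof (rule ccontr)
        assume "V \<notin> subspaces ?K d N"
        then have "?E n' (\<lambda>y. of_bool (R V y)) = ?E n' (\<lambda>y. 0)" by (simp add: R_def)
        with V \<rho>0(1) show False by (simp only: expct_const[OF u])
      qed
      \<comment> \<open>For each \<open>y\<close> in \<open>Y\<close> below, \<open>I\<close>
        followed by \<open>y\<close> is a \<open>d\<close>-dimensional subspace inside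
        \<open>C\<close>. Their union is the part removed in this round.\<close>
      define I where "I = inst ?K V ` words ?K d"
      have I: "I \<subseteq> words ?K N" using inst_words[OF subspacesD[OF VS]] by (auto simp: I_def)
      have Iexp: "?E N (\<lambda>x. of_bool (x \<in> I) * h x) = (\<Sum>z\<in>words ?K d. h (inst ?K V z)) / real ?K ^ N" for h
      proof -
        have "(\<Sum>x\<in>words ?K N. of_bool (x \<in> I) * h x) = (\<Sum>x\<in>I. h x)"
          using I by (intro sum.mono_neutral_cong_right) auto
        also have "\<dots> = (\<Sum>z\<in>words ?K d. h (inst ?K V z))"
          unfolding I_def by (subst sum.reindex[OF inj_on_inst[OF VS]]) simp
        finally show ?thesis by (simp only: expct_unif)
      qed
      define Y where "Y = {y. R V y}"
      define D where "D x = {y. x @ y \<in> C \<and> \<not> (x \<in> I \<and> y \<in> Y)}" for x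
      have split: "(of_bool (x @ y \<in> C) :: real) = of_bool (y \<in> D x) + of_bool (x \<in> I) * of_bool (y \<in> Y)" for x y
        by (auto simp: D_def I_def Y_def R_def)
      \<comment> \<open>Removing \<open>I\<close> may destroy insensitivity in the first
        \<open>N\<close> coordinates, but \<open>Y\<close> and the slices of \<open>C\<close> are
        insensitive in the others. So the induction continues in each slice separately.\<close>
      have Dins: "insensitive k i n' (D x)" if x: "x \<in> words ?K N" for x
      proof -
        have sl: "v @ y \<in> C \<longleftrightarrow> v @ repl k i y \<in> C" if "v \<in> words ?K N" "y \<in> words ?K n'" for v y
          using insensitive_slice_left[OF C' assms(3) that(1)] that(2) by (simp add: insensitive_def)
        have "y \<in> Y \<longleftrightarrow> repl k i y \<in> Y" if "y \<in> words ?K n'" for y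
          unfolding Y_def R_def using sl[OF inst_words[OF subspacesD[OF VS] _ order.refl] that] by auto
        with sl[OF x] show ?thesis by (auto simp: insensitive_def D_def)
      qed
      have dI: "1 / real ?K ^ N \<le> ?E N (\<lambda>x. of_bool (x \<in> I))"
        using Iexp[of "\<lambda>_. 1"] by (simp add: card_words divide_right_mono del: of_nat_Suc)
      \<comment> \<open>The removed part has density at least \<rho>, hence at least \<rho> times
        that of \<open>C\<close>, which is at most 1.\<close>
      have dD: "?E N (\<lambda>x. dens ?K n' (D x)) \<le> (1 - \<rho>) * dens ?K n C"
      proof -
        have "dens ?K n C = ?E N (\<lambda>x. ?E n' (\<lambda>y. of_bool (y \<in> D x) + of_bool (x \<in> I) * of_bool (y \<in> Y)))"
          unfolding n'(1) dens_append' unfolding dens_def by (simp add: split)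
        also have "\<dots> = ?E N (\<lambda>x. dens ?K n' (D x)) + ?E N (\<lambda>x. dens ?K n' Y * of_bool (x \<in> I))"
          by (simp add: expct_add expct_cmult dens_def mult.commute)
        also have "\<dots> = ?E N (\<lambda>x. dens ?K n' (D x)) + dens ?K n' Y * ?E N (\<lambda>x. of_bool (x \<in> I))"
          by (simp only: expct_cmult)
        finally have eq: "dens ?K n C = \<dots>" .
        have "\<rho> = \<rho>0 * (1 / real ?K ^ N)" by (simp add: \<rho>_def)
        also have "\<dots> \<le> dens ?K n' Y * ?E N (\<lambda>x. of_bool (x \<in> I))"
          using V \<rho>0(1) dI by (intro mult_mono) (auto simp: dens_def Y_def)
        finally have "\<rho> \<le> dens ?K n' Y * ?E N (\<lambda>x. of_bool (x \<in> I))" .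
        moreover have "\<rho> * dens ?K n C \<le> \<rho>"
          using \<rho> dens_le_1[OF K1, of n C] by (simp add: mult_left_le)
        ultimately show ?thesis using eq by (simp add: algebra_simps)
      qed
      \<comment> \<open>The mean of \<open>g\<close> over \<open>I\<close> is the contribution of
        the removed subspaces; for each \<open>y\<close> in \<open>Y\<close> the hypothesis on
        \<open>f\<close> applies to the template \<open>V @ y\<close>.\<close>
      define g where "g x = ?E n' (\<lambda>y. f (x @ y) * of_bool (y \<in> Y))" for x
      have "?E d (\<lambda>z. g (inst ?K V z))
          = ?E n' (\<lambda>y. of_bool (y \<in> Y) * ?E d (\<lambda>z. f (inst ?K V z @ y)))"
        unfolding g_def by (subst expct_swap) (simp add: mult.commute[of "f _"] expct_cmult)
      also have "\<dots> \<le> 0"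
      proof (rule expct_le_const[OF u])
        fix y assume y: "y \<in> words ?K n'"
        show "of_bool (y \<in> Y) * ?E d (\<lambda>z. f (inst ?K V z @ y)) \<le> 0"
        proof (cases "y \<in> Y")
          case True
          have "V @ y \<in> subspaces ?K d n"
            unfolding n'(1) by (rule subspaces_append_right[OF y VS])
          moreover have "inst ?K (V @ y) z = inst ?K V z @ y" for z
            using y by (simp add: inst_append inst_id)
          ultimately show ?thesis using sub True
            unfolding nonpos_on_subspaces_def by (force simp: Y_def R_def)
        qed simp
      qed
      finally have gle: "?E d (\<lambda>z. g (inst ?K V z)) \<le> 0" .
      have pos: "0 < real ?K ^ l" for l by (simp del: of_nat_Suc)
      have "?E N (\<lambda>x. of_bool (x \<in> I) * g x) \<le> 0"
        using gle unfolding Iexp unfolding expct_unif by (simp only: pos_divide_le_eq[OF pos] mult_zero_left)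
      moreover have "?E n (\<lambda>x. f x * of_bool (x \<in> C))
        = ?E N (\<lambda>x. ?E n' (\<lambda>y. f (x @ y) * of_bool (y \<in> D x))) + ?E N (\<lambda>x. of_bool (x \<in> I) * g x)"
      proof -
        have "?E n (\<lambda>x. f x * of_bool (x \<in> C))
          = ?E N (\<lambda>x. ?E n' (\<lambda>y. f (x @ y) * of_bool (y \<in> D x)
              + of_bool (x \<in> I) * (f (x @ y) * of_bool (y \<in> Y))))"
          unfolding n'(1) expct_append split by (simp add: algebra_simps)
        also have "\<dots> = ?E N (\<lambda>x. ?E n' (\<lambda>y. f (x @ y) * of_bool (y \<in> D x)))
            + ?E N (\<lambda>x. of_bool (x \<in> I) * g x)"
          by (simp only: expct_add expct_cmult g_def)
        finally show ?thesis .
      qed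
      moreover have "?E N (\<lambda>x. ?E n' (\<lambda>y. f (x @ y) * of_bool (y \<in> D x)))
          \<le> ?E N (\<lambda>x. \<kappa> + (1 - \<rho>) ^ s * dens ?K n' (D x))"
      proof (rule expct_mono[OF u])
        fix x assume x: "x \<in> words ?K N"
        show "?E n' (\<lambda>y. f (x @ y) * of_bool (y \<in> D x)) \<le> \<kappa> + (1 - \<rho>) ^ s * dens ?K n' (D x)"
        proof (rule M[OF n'(2) Dins[OF x]])
          show "\<forall>y\<in>words ?K n'. f (x @ y) \<le> 1"
            using f words_append[OF x] by (simp add: n'(1))
          show "nonpos_on_subspaces ?K d n' (D x) (\<lambda>y. f (x @ y))"
            unfolding nonpos_on_subspaces_def
          proof (intro ballI impI)
            fix W assume W: "W \<in> subspaces ?K d n'" "\<forall>z\<in>words ?K d. inst ?K W z \<in> D x"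
            have "x @ W \<in> subspaces ?K d n"
              unfolding n'(1) by (rule subspaces_append_left[OF x W(1)])
            moreover have "inst ?K (x @ W) z = x @ inst ?K W z" for z
              using x by (simp add: inst_append inst_id)
            ultimately show "?E d (\<lambda>z. f (x @ inst ?K W z)) \<le> 0"
              using sub W(2) unfolding nonpos_on_subspaces_def by (force simp: D_def)
          qed
        qed
      qed
      moreover have "?E N (\<lambda>x. \<kappa> + (1 - \<rho>) ^ s * dens ?K n' (D x))
          \<le> \<kappa> + (1 - \<rho>) ^ s * ((1 - \<rho>) * dens ?K n C)"
        unfolding expct_add expct_cmult expct_const[OF u]
        using dD \<rho> by (intro add_left_mono mult_left_mono) auto
      ultimately show ?thesis by (simp add: algebra_simps)
    qed
    then show ?case by blast
  qed
  with \<rho> show ?thesis by blast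
qed

text \<open>After enough rounds the factor \<open>(1 - \<rho>) ^ s\<close> is below
  \<open>\<kappa> / 2\<close>. The cap at 1 in \<kappa>' meets the requirement of the greedy
  lemma.\<close>

lemma insensitive_expct_le:
  assumes "DHJ k" "k \<ge> 1" "i < k" "0 < \<kappa>"
  shows "\<exists>M. \<forall>n\<ge>M. \<forall>C f. insensitive k i n C \<longrightarrow>
      (\<forall>x\<in>words (Suc k) n. f x \<le> 1) \<longrightarrow>
      nonpos_on_subspaces (Suc k) d n UNIV f \<longrightarrow>
      expct (Suc k) (unif (Suc k)) n (\<lambda>x. f x * of_bool (x \<in> C)) \<le> \<kappa>"
proof -
  let ?E = "expct (Suc k) (unif (Suc k))"
  define \<kappa>' where "\<kappa>' = min (\<kappa> / 2) 1"
  have \<kappa>': "0 < \<kappa>'" "\<kappa>' \<le> 1" "\<kappa>' \<le> \<kappa> / 2" using assms(4) by (auto simp: \<kappa>'_def)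
  from insensitive_expct_le_aux[OF assms(1-3) \<kappa>'(1,2), of d] obtain \<rho> where
    \<rho>: "0 < \<rho>" "\<rho> \<le> 1" and aux: "\<And>s. \<exists>M. \<forall>n\<ge>M. \<forall>C f. insensitive k i n C \<longrightarrow>
      (\<forall>x\<in>words (Suc k) n. f x \<le> 1) \<longrightarrow>
      nonpos_on_subspaces (Suc k) d n C f \<longrightarrow>
      ?E n (\<lambda>x. f x * of_bool (x \<in> C)) \<le> \<kappa>' + (1 - \<rho>) ^ s * dens (Suc k) n C"
    by blast
  obtain s where s: "(1 - \<rho>) ^ s < \<kappa> / 2"
    using real_arch_pow_inv[of "\<kappa> / 2" "1 - \<rho>"] \<rho> assms(4) by auto
  obtain M where M: "\<And>n C f. n \<ge> M \<Longrightarrow> insensitive k i n C \<Longrightarrow>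
      (\<forall>x\<in>words (Suc k) n. f x \<le> 1) \<Longrightarrow>
      nonpos_on_subspaces (Suc k) d n C f \<Longrightarrow>
      ?E n (\<lambda>x. f x * of_bool (x \<in> C)) \<le> \<kappa>' + (1 - \<rho>) ^ s * dens (Suc k) n C"
    using aux[of s] by blast
  have "\<kappa>' + (1 - \<rho>) ^ s * dens (Suc k) n C \<le> \<kappa>" for n C
  proof -
    have "(1 - \<rho>) ^ s * dens (Suc k) n C \<le> (1 - \<rho>) ^ s * 1"
      using \<rho> dens_le_1[of "Suc k" n C] by (intro mult_left_mono) auto
    with s \<kappa>'(3) show ?thesis by linarith
  qed
  moreover have "nonpos_on_subspaces (Suc k) d n UNIV f \<Longrightarrow> nonpos_on_subspaces (Suc k) d n C f" for n C f
    by (auto simp: nonpos_on_subspaces_def)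
  ultimately show ?thesis using M by (meson order.trans)
qed

text \<open>Induction on \<open>J\<close>. On a \<open>d1\<close>-dimensional subspace the sets
  other than \<open>C i\<close> remain insensitive, so the induction hypothesis bounds the mean of
  \<open>f\<close> on their intersection by \<open>\<kappa> / 2\<close>. Thus \<open>f\<close> cut
  down to that intersection, minus \<open>\<kappa> / 2\<close>, is admissible in the lemma for the
  single set \<open>C i\<close>.\<close>

lemma insensitive_Inter_expct_le:
  assumes "DHJ k" "k \<ge> 1" "finite J" "J \<subseteq> {..<k}" "0 < \<kappa>"
  shows "\<exists>M. \<forall>n\<ge>M. \<forall>C f. (\<forall>i\<in>J. insensitive k i n (C i)) \<longrightarrow>
      (\<forall>x\<in>words (Suc k) n. f x \<le> 1) \<longrightarrow>
      nonpos_on_subspaces (Suc k) d n UNIV f \<longrightarrow>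
      expct (Suc k) (unif (Suc k)) n (\<lambda>x. f x * of_bool (\<forall>i\<in>J. x \<in> C i)) \<le> \<kappa>"
  using assms(3,4,5)
proof (induction J arbitrary: \<kappa> rule: finite_induct)
  case empty
  let ?K = "Suc k"
  let ?E = "expct ?K (unif ?K)"
  have u: "prob_weights ?K (unif ?K)" by (rule prob_weights_unif) simp
  have "?E n f \<le> 0"
    if n: "n \<ge> d" and sub: "nonpos_on_subspaces ?K d n UNIV f" for n f
  proof -
    define n' where "n' = n - d"
    have n': "n = d + n'" using n by (simp add: n'_def)
    have "?E d (\<lambda>x. f (x @ y)) \<le> 0" if y: "y \<in> words ?K n'" for y
    proof -
      \<comment> \<open>The first \<open>d\<close> coordinates are free and the others are fixed to
        \<open>y\<close>; the whole space is the disjoint union of these subspaces.\<close>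
      define V where "V = map ((+) ?K) [0..<d] @ y"
      have "V \<in> subspaces ?K d n"
        using y by (auto simp: V_def n' subspaces_def words_def subset_iff)
      moreover have "inst ?K V z = z @ y" if "z \<in> words ?K d" for z
        using that y unfolding V_def inst_append inst_id[OF y]
        by (auto simp: inst_def words_def intro!: nth_equalityI)
      ultimately show ?thesis using sub expct_cong[of ?K d "\<lambda>z. f (inst ?K V z)" "\<lambda>z. f (z @ y)"]
        unfolding nonpos_on_subspaces_def by fastforce
    qed
    then show ?thesis
      unfolding n' expct_append by (subst expct_swap) (rule expct_le_const[OF u])
  qed
  then show ?case using empty.prems by (auto intro!: exI[of _ d] intro: order.trans[OF _ less_imp_le])
next
  case (insert i J)
  let ?K = "Suc k"
  let ?E = "expct ?K (unif ?K)"
  have u: "prob_weights ?K (unif ?K)" by (rule prob_weights_unif) simp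
  have \<kappa>2: "0 < \<kappa> / 2" and i: "i < k" and J: "J \<subseteq> {..<k}" using insert.prems by auto
  obtain d1 where d1: "\<And>C f. \<forall>j\<in>J. insensitive k j d1 (C j) \<Longrightarrow>
      \<forall>x\<in>words ?K d1. f x \<le> 1 \<Longrightarrow> nonpos_on_subspaces ?K d d1 UNIV f \<Longrightarrow>
      ?E d1 (\<lambda>x. f x * of_bool (\<forall>i\<in>J. x \<in> C i)) \<le> \<kappa> / 2"
    using insert.IH[OF J \<kappa>2] by blast
  obtain M where M: "\<And>n C f. n \<ge> M \<Longrightarrow> insensitive k i n C \<Longrightarrow>
      \<forall>x\<in>words ?K n. f x \<le> 1 \<Longrightarrow> nonpos_on_subspaces ?K d1 n UNIV f \<Longrightarrow>
      ?E n (\<lambda>x. f x * of_bool (x \<in> C)) \<le> \<kappa> / 2"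
    using insensitive_expct_le[OF assms(1,2) i \<kappa>2, of d1] by blast
  have "?E n (\<lambda>x. f x * of_bool (\<forall>i\<in>insert i J. x \<in> C i)) \<le> \<kappa>"
    if n: "n \<ge> M" and C: "\<forall>j\<in>insert i J. insensitive k j n (C j)"
      and f: "\<forall>x\<in>words ?K n. f x \<le> 1"
      and sub: "nonpos_on_subspaces ?K d n UNIV f" for n C f
  proof -
    define g where "g x = f x * of_bool (\<forall>j\<in>J. x \<in> C j) - \<kappa> / 2" for x
    have "?E n (\<lambda>x. g x * of_bool (x \<in> C i)) \<le> \<kappa> / 2"
    proof (rule M[OF n])
      show "insensitive k i n (C i)" using C by simp
      show "\<forall>x\<in>words ?K n. g x \<le> 1"
        using f \<kappa>2 by (force simp: g_def of_bool_def)
      show "nonpos_on_subspaces ?K d1 n UNIV g"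
        unfolding nonpos_on_subspaces_def
      proof (intro ballI impI)
        fix V assume V: "V \<in> subspaces ?K d1 n"
        have "?E d1 (\<lambda>z. f (inst ?K V z) * of_bool (\<forall>j\<in>J. z \<in> {z. inst ?K V z \<in> C j})) \<le> \<kappa> / 2"
        proof (rule d1)
          show "\<forall>j\<in>J. insensitive k j d1 {z. inst ?K V z \<in> C j}"
            using C J by (auto intro!: insensitive_inst[OF _ _ subspacesD[OF V]])
          show "\<forall>x\<in>words ?K d1. f (inst ?K V x) \<le> 1"
            using f inst_words[OF subspacesD[OF V]] by simp
          show "nonpos_on_subspaces ?K d d1 UNIV (\<lambda>x. f (inst ?K V x))"
            unfolding nonpos_on_subspaces_def
          proof (intro ballI impI)
            fix W assume W: "W \<in> subspaces ?K d d1"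
            show "?E d (\<lambda>z. f (inst ?K V (inst ?K W z))) \<le> 0"
              using sub inst_subspaces[OF V W] inst_inst[OF subspacesD[OF V] subspacesD[OF W]]
              by (force simp: nonpos_on_subspaces_def)
          qed
        qed
        then show "?E d1 (\<lambda>z. g (inst ?K V z)) \<le> 0"
          unfolding g_def expct_diff expct_const[OF u] by simp
      qed
    qed
    moreover have "?E n (\<lambda>x. f x * of_bool (\<forall>i\<in>insert i J. x \<in> C i))
      = ?E n (\<lambda>x. g x * of_bool (x \<in> C i)) + \<kappa> / 2 * dens ?K n (C i)"
    proof -
      have "f x * of_bool (\<forall>i\<in>insert i J. x \<in> C i)
          = g x * of_bool (x \<in> C i) + \<kappa> / 2 * of_bool (x \<in> C i)" for x
        by (auto simp: g_def of_bool_def)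
      then show ?thesis by (simp only: expct_add expct_cmult dens_def)
    qed
    moreover have "\<kappa> / 2 * dens ?K n (C i) \<le> \<kappa> / 2 * 1"
      using \<kappa>2 dens_le_1[of ?K n "C i"] by (intro mult_left_mono) auto
    ultimately show ?thesis by linarith
  qed
  then show ?case by blast
qed

section \<open>The density Hales-Jewett theorem\<close>

text \<open>\<delta> is the supremum of the densities that line-free sets reach in every dimension.
  Slices of line-free sets are line-free, so a density reached in arbitrarily high dimension is
  reached in all, and an upper bound in one dimension persists in all higher ones.\<close>

lemma not_DHJ_critical:
  assumes "k \<ge> 1" "\<not> DHJ k"
  obtains \<delta> where "\<delta> > 0"
    "\<And>\<epsilon> n. \<epsilon> > 0 \<Longrightarrow> \<exists>A. \<delta> - \<epsilon> \<le> dens k n A \<and> \<not> has_line k n A"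
    "\<And>\<epsilon>. \<epsilon> > 0 \<Longrightarrow> \<exists>N. \<forall>n\<ge>N. \<forall>A. \<not> has_line k n A \<longrightarrow> dens k n A \<le> \<delta> + \<epsilon>"
proof -
  note u = prob_weights_unif[OF assms(1)]
  define S where "S = {\<delta>. \<forall>n. \<exists>A. \<delta> \<le> dens k n A \<and> \<not> has_line k n A}"
  obtain \<delta>0 where \<delta>0: "\<delta>0 > 0" "\<And>N. \<exists>n\<ge>N. \<exists>A. \<delta>0 \<le> dens k n A \<and> \<not> has_line k n A"
    using assms(2) unfolding DHJ_def by blast
  have "\<delta>0 \<in> S"
    unfolding S_def
  proof (intro CollectI allI)
    fix n
    obtain n' A where n': "n' \<ge> n" "\<delta>0 \<le> dens k n' A" "\<not> has_line k n' A"
      using \<delta>0(2) by blast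
    define m where "m = n' - n"
    have m: "n' = m + n" using n'(1) by (simp add: m_def)
    obtain x where x: "x \<in> words k m" "\<delta>0 \<le> dens k n {y. x @ y \<in> A}"
      using n'(2) expct_exists[OF u] unfolding m dens_append' by blast
    then show "\<exists>A. \<delta>0 \<le> dens k n A \<and> \<not> has_line k n A"
      using n'(3) has_line_append_left[OF x(1)] unfolding m by blast
  qed
  have bdd: "bdd_above S"
  proof (rule bdd_aboveI)
    fix s assume "s \<in> S"
    then obtain A where "s \<le> dens k 0 A" by (auto simp: S_def)
    then show "s \<le> 1" using dens_le_1[OF assms(1), of 0 A] by linarith
  qed
  define \<delta> where "\<delta> = Sup S"
  have "\<delta>0 \<le> \<delta>" unfolding \<delta>_def by (rule cSup_upper[OF \<open>\<delta>0 \<in> S\<close> bdd])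
  show thesis
  proof (rule that)
    show "\<delta> > 0" using \<delta>0(1) \<open>\<delta>0 \<le> \<delta>\<close> by linarith
    fix \<epsilon> :: real assume \<epsilon>: "\<epsilon> > 0"
    have "\<exists>s\<in>S. \<delta> - \<epsilon> < s"
      using \<epsilon> \<open>\<delta>0 \<in> S\<close> bdd less_cSup_iff[of S "\<delta> - \<epsilon>"] by (auto simp: \<delta>_def)
    then obtain s where s: "s \<in> S" "\<delta> - \<epsilon> < s" by blast
    show "\<exists>A. \<delta> - \<epsilon> \<le> dens k n A \<and> \<not> has_line k n A" for n
    proof -
      obtain A where "s \<le> dens k n A" "\<not> has_line k n A" using s(1) by (auto simp: S_def)
      with s(2) show ?thesis by (intro exI[of _ A]) auto
    qed
    have "\<delta> + \<epsilon> \<notin> S"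
      using cSup_upper[OF _ bdd, of "\<delta> + \<epsilon>"] \<epsilon> by (auto simp: \<delta>_def)
    then obtain N where N: "\<And>A. \<not> has_line k N A \<Longrightarrow> dens k N A \<le> \<delta> + \<epsilon>"
      by (auto simp: S_def not_le) (meson less_imp_le not_le)
    have "dens k n A \<le> \<delta> + \<epsilon>" if "n \<ge> N" "\<not> has_line k n A" for n A
    proof -
      define m where "m = n - N"
      have m: "n = N + m" using that(1) by (simp add: m_def)
      show ?thesis
        unfolding m dens_append
        using that(2) has_line_append_right[of _ k m N A] unfolding m
        by (intro expct_le_const[OF u] N) blast
    qed
    then show "\<exists>N. \<forall>n\<ge>N. \<forall>A. \<not> has_line k n A \<longrightarrow> dens k n A \<le> \<delta> + \<epsilon>" by blast
  qed
qed

text \<open>A set violating the bound would have uniform density above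
  \<open>\<delta> + \<epsilon> / 3\<close> on a large coordinate subspace, where its trace is still
  line-free.\<close>

lemma line_free_weighted_le:
  assumes "k \<ge> 1" "\<eta> > 0" "\<epsilon> > 0" "\<delta> > 0"
    and crit: "\<And>\<epsilon>. \<epsilon> > 0 \<Longrightarrow> \<exists>N. \<forall>n\<ge>N. \<forall>A. \<not> has_line k n A \<longrightarrow> dens k n A \<le> \<delta> + \<epsilon>"
  shows "\<exists>N. \<forall>n\<ge>N. \<forall>p A. prob_weights k p \<longrightarrow> (\<forall>a<k. \<eta> \<le> p a) \<longrightarrow>
    \<not> has_line k n A \<longrightarrow> expct k p n (\<lambda>x. of_bool (x \<in> A)) \<le> \<delta> + \<epsilon>"
proof -
  have e3: "\<epsilon> / 3 > 0" using assms(3) by simp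
  obtain M where M: "\<And>n A. n \<ge> M \<Longrightarrow> \<not> has_line k n A \<Longrightarrow> dens k n A \<le> \<delta> + \<epsilon> / 3"
    using crit[OF e3] by blast
  obtain N where N: "\<And>n p f c. n \<ge> N \<Longrightarrow> prob_weights k p \<Longrightarrow> (\<forall>a<k. \<eta> \<le> p a) \<Longrightarrow>
    (\<forall>x\<in>words k n. f x \<le> 1) \<Longrightarrow> 0 \<le> c \<Longrightarrow> c \<le> expct k p n f \<Longrightarrow>
    (\<exists>T\<in>words (Suc k) n. M \<le> count_list T k \<and>
      c - \<epsilon> / 3 \<le> expct k (unif k) (count_list T k) (\<lambda>z. f (fill k T z)))"
    using exists_fill[OF assms(1,2) e3, of M] by blast
  have "expct k p n (\<lambda>x. of_bool (x \<in> A)) \<le> \<delta> + \<epsilon>"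
    if h: "n \<ge> N" "prob_weights k p" "\<forall>a<k. \<eta> \<le> p a" "\<not> has_line k n A" for n p A
  proof (rule ccontr)
    assume "\<not> ?thesis"
    then have le: "\<delta> + \<epsilon> \<le> expct k p n (\<lambda>x. of_bool (x \<in> A))" by simp
    obtain T where T: "T \<in> words (Suc k) n" "M \<le> count_list T k"
      "\<delta> + \<epsilon> - \<epsilon> / 3 \<le> dens k (count_list T k) {z. fill k T z \<in> A}"
      using N[OF h(1-3) _ _ le] assms(3,4) by (auto simp: dens_def)
    have "\<not> has_line k (count_list T k) {z. fill k T z \<in> A}"
      using has_line_fill[OF T(1)] h(4) by blast
    from M[OF T(2) this] T(3) assms(3) show False by simp
  qed
  then show ?thesis by blast
qed

text \<open>Sorting by the first failing index cuts the complement of an intersection into disjoint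
  pieces.\<close>

lemma sum_first_failure:
  "(\<Sum>j<(k::nat). of_bool ((\<forall>i<j. P i) \<and> \<not> P j) :: real) = 1 - of_bool (\<forall>j<k. P j)"
  by (induction k) (auto simp: less_Suc_eq)

lemma expct_avoid:
  assumes "prob_weights (Suc k) p"
  shows "expct (Suc k) p n (\<lambda>x. of_bool (k \<notin> set x)) = (1 - p k) ^ n"
proof -
  have "expct (Suc k) p n (\<lambda>x. of_bool (k \<notin> set x)) = expct (Suc k) p n (\<lambda>x. 0 ^ count_list x k)"
    by (intro expct_cong) (auto simp: count_list_0_iff power_0_left)
  then show ?thesis using expct_count[OF assms, of n 0] by simp
qed

section \<open>The density increment from \<open>k\<close> to \<open>k + 1\<close> letters\<close>

lemma DHJ_Suc:
  assumes dhj: "DHJ k" and k: "k \<ge> 1"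
  shows "DHJ (Suc k)"
proof (rule ccontr)
  let ?K = "Suc k"
  let ?u = "unif ?K"
  have u: "prob_weights ?K ?u" by (rule prob_weights_unif) simp
  have uk: "prob_weights k (unif k)" by (rule prob_weights_unif[OF k])
  assume "\<not> DHJ ?K"
  then obtain \<delta> where \<delta>: "\<delta> > 0"
    and lower: "\<And>\<epsilon> n. \<epsilon> > 0 \<Longrightarrow> \<exists>A. \<delta> - \<epsilon> \<le> dens ?K n A \<and> \<not> has_line ?K n A"
    and upper: "\<And>\<epsilon>. \<epsilon> > 0 \<Longrightarrow> \<exists>N. \<forall>n\<ge>N. \<forall>A. \<not> has_line ?K n A \<longrightarrow> dens ?K n A \<le> \<delta> + \<epsilon>"
    using not_DHJ_critical[of ?K] by (metis le_add1 plus_1_eq_Suc)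
  have "\<delta> / 4 > 0" using \<delta> by simp
  then obtain q where q: "\<And>A. \<delta> / 4 \<le> dens k q A \<Longrightarrow> has_line k q A"
    using dhj unfolding DHJ_def by blast
  define cq where "cq = real (card (words ?K q))"
  have cq: "cq \<ge> 1" by (simp add: cq_def card_words)
  \<comment> \<open>A good line will lie in the slices of \<open>A\<close> for a proportion \<theta>
    of the suffixes, and good lines will have measure at least \<open>1 / cq\<close>, which gives
    \<beta>; \<eta> bounds the atoms of that measure. In the final count the gain
    \<open>\<delta> * \<beta> / 2\<close> loses \<gamma> and
    \<open>\<epsilon> + 6 * \<epsilon> / \<beta>\<close>, each at most
    \<open>\<delta> * \<beta> / 8\<close>, which leaves \<open>real k * \<kappa>\<close>.\<close>
  define \<theta> where "\<theta> = \<delta> / 4 / cq"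
  define \<beta> where "\<beta> = \<theta> / cq"
  define \<eta> where "\<eta> = 1 / real (k + q)"
  define \<gamma> where "\<gamma> = \<delta> * \<beta> / 8"
  define \<kappa> where "\<kappa> = \<delta> * \<beta> / (4 * real k)"
  define \<epsilon> where "\<epsilon> = min (\<delta> / 4) (\<delta> * \<beta> / (8 * (6 / \<beta> + 1)))"
  have \<theta>: "\<theta> > 0" and \<beta>: "\<beta> > 0" using \<delta> cq by (auto simp: \<theta>_def \<beta>_def)
  have \<gamma>: "\<gamma> > 0" and \<kappa>: "\<kappa> > 0" and \<eta>: "\<eta> > 0"
    using \<delta> \<beta> k by (auto simp: \<gamma>_def \<kappa>_def \<eta>_def)
  have "6 / \<beta> + 1 > 0" using \<beta> by (simp add: add_pos_pos)
  then have \<epsilon>: "\<epsilon> > 0" "2 * \<epsilon> \<le> \<delta> / 2" "\<epsilon> * (6 / \<beta> + 1) \<le> \<delta> * \<beta> / 8"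
  proof -
    show "\<epsilon> > 0" using \<delta> \<beta> \<open>6 / \<beta> + 1 > 0\<close> by (simp add: \<epsilon>_def)
    have "\<epsilon> \<le> \<delta> / 4" unfolding \<epsilon>_def by (rule min.cobounded1)
    then show "2 * \<epsilon> \<le> \<delta> / 2" by simp
    have "\<epsilon> \<le> \<delta> * \<beta> / 8 / (6 / \<beta> + 1)" by (simp add: \<epsilon>_def)
    then show "\<epsilon> * (6 / \<beta> + 1) \<le> \<delta> * \<beta> / 8"
      using \<open>6 / \<beta> + 1 > 0\<close> by (simp only: pos_le_divide_eq)
  qed
  obtain d where d: "\<And>A. \<not> has_line ?K d A \<Longrightarrow> dens ?K d A \<le> \<delta> + \<gamma>"
    using upper[OF \<gamma>] by blast
  have \<kappa>4: "\<kappa> / 4 > 0" and \<kappa>2: "\<kappa> / 2 > 0" using \<kappa> by auto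
  obtain M where M: "\<And>n C f. n \<ge> M \<Longrightarrow> \<forall>i\<in>{..<k}. insensitive k i n (C i) \<Longrightarrow>
      \<forall>x\<in>words ?K n. f x \<le> 1 \<Longrightarrow> nonpos_on_subspaces ?K d n UNIV f \<Longrightarrow>
      expct ?K ?u n (\<lambda>x. f x * of_bool (\<forall>i\<in>{..<k}. x \<in> C i)) \<le> \<kappa> / 4"
    using insensitive_Inter_expct_le[OF dhj k finite_lessThan order.refl \<kappa>4, of d] by blast
  have K1: "?K \<ge> 1" by simp
  obtain N1 where N1: "\<And>n p f c. n \<ge> N1 \<Longrightarrow> prob_weights ?K p \<Longrightarrow> (\<forall>a<?K. \<eta> \<le> p a) \<Longrightarrow>
    (\<forall>x\<in>words ?K n. f x \<le> 1) \<Longrightarrow> 0 \<le> c \<Longrightarrow> c \<le> expct ?K p n f \<Longrightarrow>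
    (\<exists>T\<in>words (Suc ?K) n. M \<le> count_list T ?K \<and>
      c - \<kappa> / 2 \<le> expct ?K ?u (count_list T ?K) (\<lambda>z. f (fill ?K T z)))"
    using exists_fill[OF K1 \<eta> \<kappa>2, of M] by blast
  have "\<eta> \<le> 1" using k by (simp add: \<eta>_def)
  then have "(\<lambda>n. (1 - \<eta>) ^ n) \<longlonglongrightarrow> 0" using \<eta> by (intro LIMSEQ_realpow_zero) auto
  then have "eventually (\<lambda>n. (1 - \<eta>) ^ n < \<epsilon>) sequentially"
    using \<epsilon>(1) by (intro order_tendstoD) auto
  then obtain N2 where N2: "\<And>n. n \<ge> N2 \<Longrightarrow> (1 - \<eta>) ^ n < \<epsilon>"
    by (auto simp: eventually_sequentially)
  obtain N3 where N3: "\<And>n p A. n \<ge> N3 \<Longrightarrow> prob_weights ?K p \<Longrightarrow> (\<forall>a<?K. \<eta> \<le> p a) \<Longrightarrow>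
      \<not> has_line ?K n A \<Longrightarrow> expct ?K p n (\<lambda>x. of_bool (x \<in> A)) \<le> \<delta> + \<epsilon>"
    using line_free_weighted_le[OF K1 \<eta> \<epsilon>(1) \<delta> upper] by blast
  define m where "m = max N1 (max N2 N3)"
  have m: "m \<ge> N1" "m \<ge> N2" "m \<ge> N3" by (auto simp: m_def)
  \<comment> \<open>Divided by the number of prefixes: if the mean of the slice densities is at
    least \<open>\<delta> - \<epsilon>'\<close> and none exceeds
    \<open>\<delta> + \<epsilon>'\<close>, then every single one is at least
    \<open>\<delta> - 2 * \<epsilon>\<close>. The bound for every prefix allows any template and any
    product measure below.\<close>
  define \<epsilon>' where "\<epsilon>' = \<epsilon> / real ?K ^ m"
  have \<epsilon>': "\<epsilon>' > 0" using \<epsilon>(1) by (simp add: \<epsilon>'_def del: of_nat_Suc)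
  obtain n where n: "\<And>A. \<not> has_line ?K n A \<Longrightarrow> dens ?K n A \<le> \<delta> + \<epsilon>'"
    using upper[OF \<epsilon>'] by blast
  obtain A where A: "\<delta> - \<epsilon>' \<le> dens ?K (m + n) A" "\<not> has_line ?K (m + n) A"
    using lower[OF \<epsilon>'] by blast
  let ?E = "expct ?K ?u n"
  have slice: "\<delta> - 2 * \<epsilon> \<le> dens ?K n {y. x @ y \<in> A}" if x: "x \<in> words ?K m" for x
  proof -
    define a where "a x = dens ?K n {y. x @ y \<in> A}" for x
    have a: "a x \<le> \<delta> + \<epsilon>'" if "x \<in> words ?K m" for x
      unfolding a_def using n has_line_append_left[OF that] A(2) by blast
    have pos: "0 < real ?K ^ m" by (simp del: of_nat_Suc)
    have "\<delta> - \<epsilon>' \<le> (\<Sum>x\<in>words ?K m. a x) / real ?K ^ m"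
      using A(1) unfolding dens_append' expct_unif a_def .
    then have "(\<delta> - \<epsilon>') * real ?K ^ m \<le> (\<Sum>x\<in>words ?K m. a x)"
      using pos by (simp only: pos_le_divide_eq)
    also have "\<dots> = a x + (\<Sum>x\<in>words ?K m - {x}. a x)"
      using x by (simp add: sum.remove)
    also have "(\<Sum>x\<in>words ?K m - {x}. a x) \<le> (\<Sum>x\<in>words ?K m - {x}. \<delta> + \<epsilon>')"
      using a by (intro sum_mono) auto
    also have "\<dots> = (\<delta> + \<epsilon>') * (real ?K ^ m - 1)"
    proof -
      have "1 \<le> ?K ^ m" by simp
      then have "real (?K ^ m - 1) = real ?K ^ m - 1" by (simp only: of_nat_diff of_nat_power of_nat_1)
      then show ?thesis using x by (simp add: card_words card_Diff_singleton del: of_nat_Suc)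
    qed
    finally have "a x \<ge> \<delta> + \<epsilon>' - 2 * (\<epsilon>' * real ?K ^ m)"
      by (simp add: algebra_simps del: of_nat_Suc)
    moreover have "\<epsilon>' * real ?K ^ m = \<epsilon>" by (simp add: \<epsilon>'_def del: of_nat_Suc)
    ultimately show ?thesis using \<epsilon>' by (simp add: a_def)
  qed
  \<comment> \<open>A word \<open>z\<close> over \<open>k + 1\<close> letters is also read as a line
    template over \<open>k\<close> letters with wildcard \<open>k\<close>; \<open>D y\<close>
    collects those whose \<open>k\<close> points all lie in the slice of \<open>A\<close> at
    \<open>y\<close>.\<close>
  define D where "D y = {z. \<forall>j<k. repl k j z @ y \<in> A}" for y
  define G where "G z \<longleftrightarrow> \<theta> \<le> ?E (\<lambda>y. of_bool (z \<in> D y))" for z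
  \<comment> \<open>For many \<open>y\<close> the trace of the slice on the \<open>k\<close>-letter
    parameters of \<open>V\<close> has density at least \<open>\<delta> / 4\<close> and so contains
    a line; pigeonhole makes one parameter line \<open>w\<close> work for a proportion \<theta> of
    all \<open>y\<close>.\<close>
  have good: "\<exists>w\<in>words ?K q. k \<in> set w \<and> G (inst k V w)" if V: "V \<in> words (k + q) m" for V
  proof -
    have "\<delta> / 2 \<le> expct k (unif k) q (\<lambda>x. dens ?K n {y. inst k V x @ y \<in> A})"
    proof -
      have "\<delta> / 2 \<le> dens ?K n {y. inst k V x @ y \<in> A}" if "x \<in> words k q" for x
        using slice[of "inst k V x"] inst_words[OF V that] words_mono[of k ?K m] \<epsilon>(2) by fastforce
      then have "expct k (unif k) q (\<lambda>_. \<delta> / 2) \<le> expct k (unif k) q (\<lambda>x. dens ?K n {y. inst k V x @ y \<in> A})"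
        by (intro expct_mono[OF uk])
      then show ?thesis by (simp only: expct_const[OF uk])
    qed
    also have "\<dots> = ?E (\<lambda>y. dens k q {x. inst k V x @ y \<in> A})"
      unfolding dens_def by (subst expct_swap) simp
    finally have "\<delta> / 2 / 2 \<le> ?E (\<lambda>y. of_bool (\<delta> / 2 / 2 \<le> dens k q {x. inst k V x @ y \<in> A}))"
      using \<delta> dens_le_1[OF k] by (intro expct_Markov[OF u]) auto
    moreover have "\<exists>w\<in>words ?K q. k \<in> set w \<and> (\<forall>j<k. inst k V (repl k j w) @ y \<in> A)"
      if "\<delta> / 2 / 2 \<le> dens k q {x. inst k V x @ y \<in> A}" for y
      using q[of "{x. inst k V x @ y \<in> A}"] that by (auto simp: has_line_def)
    moreover have "words ?K q \<noteq> {}" by (rule words_nonempty) simp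
    ultimately have "\<exists>w\<in>words ?K q. \<delta> / 2 / 2 / real (card (words ?K q)) \<le>
        ?E (\<lambda>y. of_bool (k \<in> set w \<and> (\<forall>j<k. inst k V (repl k j w) @ y \<in> A)))"
      by (intro expct_pigeonhole[OF u finite_words]) auto
    then obtain w where w: "w \<in> words ?K q"
      "\<theta> \<le> ?E (\<lambda>y. of_bool (k \<in> set w \<and> (\<forall>j<k. inst k V (repl k j w) @ y \<in> A)))"
      by (auto simp: \<theta>_def cq_def)
    have kw: "k \<in> set w"
    proof (rule ccontr)
      assume "k \<notin> set w"
      then show False using w(2) \<theta> expct_const[OF u, of n 0] by simp
    qed
    have "repl k j (inst k V w) = inst k V (repl k j w)" for j
      unfolding repl_def using words_length[OF w(1)] by (intro map_inst[OF V]) auto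
    with w(2) kw have "G (inst k V w)" by (simp add: G_def D_def)
    with w(1) kw show ?thesis by blast
  qed
  \<comment> \<open>Choose \<open>V\<close> uniformly. By pigeonhole one fixed \<open>w\<close> is
    good for a proportion \<open>1 / cq\<close> of the \<open>V\<close>. Then the letters of
    \<open>inst k V w\<close> are independent, and \<nu> is the law of one of them; each letter,
    including \<open>k\<close> since it occurs in \<open>w\<close>, has a preimage of weight
    \<eta>.\<close>
  obtain \<nu> where \<nu>: "prob_weights ?K \<nu>" "\<forall>a<?K. \<eta> \<le> \<nu> a" "1 / cq \<le> expct ?K \<nu> m (\<lambda>z. of_bool (G z))"
  proof -
    have uq: "prob_weights (k + q) (unif (k + q))" by (rule prob_weights_unif) (use k in simp)
    have one: "1 \<le> expct (k + q) (unif (k + q)) m (\<lambda>_. of_bool True)"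
      unfolding expct_const[OF uq] by simp
    have "\<exists>w\<in>words ?K q. 1 / real (card (words ?K q)) \<le>
        expct (k + q) (unif (k + q)) m (\<lambda>V. of_bool (k \<in> set w \<and> G (inst k V w)))"
      by (rule expct_pigeonhole[OF uq finite_words words_nonempty _ one]) (use good in auto)
    then obtain w where w: "w \<in> words ?K q"
      "1 / cq \<le> expct (k + q) (unif (k + q)) m (\<lambda>V. of_bool (k \<in> set w \<and> G (inst k V w)))"
      by (auto simp: cq_def)
    have kw: "k \<in> set w"
    proof (rule ccontr)
      assume "k \<notin> set w"
      then show False using w(2) cq expct_const[OF uq, of m 0] by simp
    qed
    define g where "g a = (if a < k then a else w ! (a - k))" for a
    have g: "g a < ?K" if "a < k + q" for a
      using that w(1) by (auto simp: g_def words_def subset_iff)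
    define \<nu> where "\<nu> b = (\<Sum>a | a < k + q \<and> g a = b. unif (k + q) a)" for b
    have "prob_weights ?K \<nu>" unfolding \<nu>_def by (rule prob_weights_map[OF uq g])
    moreover have "\<eta> \<le> \<nu> b" if b: "b < ?K" for b
    proof -
      have "\<exists>a<k + q. g a = b"
      proof (cases "b < k")
        case True
        then show ?thesis by (intro exI[of _ b]) (simp add: g_def)
      next
        case False
        then have "b = k" using b by simp
        obtain i where "i < q" "w ! i = k" using kw words_length[OF w(1)] by (auto simp: in_set_conv_nth)
        then show ?thesis using \<open>b = k\<close> by (intro exI[of _ "k + i"]) (simp add: g_def)
      qed
      then obtain a where a: "a < k + q" "g a = b" by blast
      have "unif (k + q) a \<le> (\<Sum>a | a < k + q \<and> g a = b. unif (k + q) a)"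
        by (rule member_le_sum[of a _ "unif (k + q)"]) (use a in auto)
      then show ?thesis by (simp add: \<eta>_def \<nu>_def)
    qed
    moreover have "1 / cq \<le> expct ?K \<nu> m (\<lambda>z. of_bool (G z))"
      using w(2) kw expct_map[of "k + q" g ?K "unif (k + q)" m "\<lambda>z. of_bool (G z)", OF g]
      by (simp add: inst_def g_def[abs_def] \<nu>_def[abs_def])
    ultimately show thesis using that by blast
  qed
  let ?F = "expct ?K \<nu> m"
  have EFD: "\<beta> \<le> ?E (\<lambda>y. ?F (\<lambda>z. of_bool (z \<in> D y)))"
  proof -
    have "\<beta> \<le> \<theta> * ?F (\<lambda>z. of_bool (G z))"
      using mult_left_mono[OF \<nu>(3), of \<theta>] \<theta> by (simp add: \<beta>_def)
    also have "\<dots> = ?F (\<lambda>z. \<theta> * of_bool (G z))" by (simp only: expct_cmult)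
    also have "\<dots> \<le> ?F (\<lambda>z. ?E (\<lambda>y. of_bool (z \<in> D y)))"
    proof (rule expct_mono[OF \<nu>(1)])
      show "\<theta> * of_bool (G z) \<le> ?E (\<lambda>y. of_bool (z \<in> D y))" for z
        using expct_nonneg[OF u, of n "\<lambda>y. of_bool (z \<in> D y)"] by (cases "G z") (auto simp: G_def)
    qed
    also have "\<dots> = ?E (\<lambda>y. ?F (\<lambda>z. of_bool (z \<in> D y)))" by (rule expct_swap)
    finally show ?thesis .
  qed
  have EFA: "\<delta> - 2 * \<epsilon> \<le> ?E (\<lambda>y. ?F (\<lambda>x. of_bool (x @ y \<in> A)))"
  proof -
    have "\<delta> - 2 * \<epsilon> = ?F (\<lambda>_. \<delta> - 2 * \<epsilon>)" by (simp only: expct_const[OF \<nu>(1)])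
    also have "\<dots> \<le> ?F (\<lambda>x. ?E (\<lambda>y. of_bool (x @ y \<in> A)))"
      using slice by (intro expct_mono[OF \<nu>(1)]) (simp add: dens_def)
    also have "\<dots> = ?E (\<lambda>y. ?F (\<lambda>x. of_bool (x @ y \<in> A)))" by (rule expct_swap)
    finally show ?thesis .
  qed
  \<comment> \<open>A multiplier that controls two means with one \<open>y\<close>: the mean of the
    second falls short of \<open>\<delta> + \<epsilon>\<close> by at most
    \<open>3 * \<epsilon>\<close>, and \<mu> times this is \<open>\<beta> / 2\<close>, half of the
    first mean.\<close>
  define \<mu> where "\<mu> = \<beta> / (6 * \<epsilon>)"
  have \<mu>: "\<mu> > 0" using \<beta> \<epsilon>(1) by (simp add: \<mu>_def)
  have "\<beta> / 2 \<le> ?E (\<lambda>y. ?F (\<lambda>z. of_bool (z \<in> D y)) + \<mu> * (?F (\<lambda>x. of_bool (x @ y \<in> A)) - (\<delta> + \<epsilon>)))"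
  proof -
    have "\<mu> * (\<delta> - 2 * \<epsilon> - (\<delta> + \<epsilon>)) = - (\<beta> / 2)"
      using \<epsilon>(1) by (simp add: \<mu>_def)
    moreover have "\<mu> * (\<delta> - 2 * \<epsilon> - (\<delta> + \<epsilon>)) \<le> \<mu> * (?E (\<lambda>y. ?F (\<lambda>x. of_bool (x @ y \<in> A))) - (\<delta> + \<epsilon>))"
      using EFA \<mu> by (intro mult_left_mono) auto
    ultimately show ?thesis
      using EFD unfolding expct_add expct_cmult expct_diff expct_const[OF u] by linarith
  qed
  from expct_exists[OF u this] obtain y where y: "y \<in> words ?K n"
    "\<beta> / 2 \<le> ?F (\<lambda>z. of_bool (z \<in> D y)) + \<mu> * (?F (\<lambda>x. of_bool (x @ y \<in> A)) - (\<delta> + \<epsilon>))"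
    by blast
  define B where "B = {x. x @ y \<in> A}"
  have B: "\<not> has_line ?K m B"
    unfolding B_def using has_line_append_right[OF y(1)] A(2) by blast
  define FB where "FB = ?F (\<lambda>x. of_bool (x \<in> B))"
  define FD where "FD = ?F (\<lambda>x. of_bool (x \<in> D y))"
  have y': "\<beta> / 2 \<le> FD + \<mu> * (FB - (\<delta> + \<epsilon>))" using y(2) by (simp add: FB_def FD_def B_def)
  have FB: "FB \<le> \<delta> + \<epsilon>" unfolding FB_def using N3[OF m(3) \<nu>(1,2) B] .
  have FD1: "FD \<le> 1" unfolding FD_def by (rule expct_le_const[OF \<nu>(1)]) simp
  have FD: "\<beta> / 2 \<le> FD"
    using y' FB \<mu> mult_nonneg_nonpos[of \<mu> "FB - (\<delta> + \<epsilon>)"] by linarith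
  have FB': "\<delta> - 6 * \<epsilon> / \<beta> \<le> FB"
  proof -
    have "- 1 \<le> \<mu> * (FB - (\<delta> + \<epsilon>))" using y' FD1 \<beta> by linarith
    then have "- 1 / \<mu> \<le> FB - (\<delta> + \<epsilon>)" by (simp only: pos_divide_le_eq[OF \<mu>] mult.commute[of _ \<mu>])
    moreover have "1 / \<mu> = 6 * \<epsilon> / \<beta>" by (simp add: \<mu>_def)
    ultimately show ?thesis using \<epsilon>(1) by simp
  qed
  \<comment> \<open>Otherwise \<open>x\<close>, with \<open>k\<close> as wildcard, is a line in
    \<open>B\<close> over \<open>k + 1\<close> letters: \<open>D y\<close> supplies the points for
    \<open>j < k\<close>, and \<open>x\<close> itself is the point for \<open>k\<close>.\<close>
  have disj: "k \<notin> set x" if x: "x \<in> words ?K m" "x \<in> B" "x \<in> D y" for x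
  proof
    assume kx: "k \<in> set x"
    define w where "w = map (\<lambda>a. if a = k then ?K else a) x"
    have "w \<in> words (Suc ?K) m" using x(1) by (auto simp: w_def words_def)
    moreover have "?K \<in> set w" using kx by (auto simp: w_def)
    moreover have "repl ?K j w \<in> B" if "j < ?K" for j
    proof -
      have "repl ?K j w = repl k j x"
        using x(1) by (auto simp: w_def repl_def words_def)
      moreover have "repl k k x = x" by (auto simp: repl_def intro: map_idI)
      ultimately show ?thesis
        using x(2,3) that by (cases "j = k") (auto simp: D_def B_def)
    qed
    ultimately show False using B unfolding has_line_def by blast
  qed
  have FBD: "?F (\<lambda>x. of_bool (x \<in> B) * of_bool (x \<in> D y)) \<le> \<epsilon>"
  proof -
    have "?F (\<lambda>x. of_bool (x \<in> B) * of_bool (x \<in> D y)) \<le> ?F (\<lambda>x. of_bool (k \<notin> set x))"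
      using disj by (intro expct_mono[OF \<nu>(1)]) (auto simp: of_bool_def)
    also have "\<dots> = (1 - \<nu> k) ^ m" by (rule expct_avoid[OF \<nu>(1)])
    also have "\<dots> \<le> (1 - \<eta>) ^ m"
    proof (rule power_mono)
      show "1 - \<nu> k \<le> 1 - \<eta>" using \<nu>(2) by simp
      have "(\<Sum>a<k. \<nu> a) \<ge> 0" using \<nu>(1) by (auto simp: prob_weights_def intro!: sum_nonneg)
      then show "0 \<le> 1 - \<nu> k" using \<nu>(1) by (simp add: prob_weights_def)
    qed
    finally show ?thesis using N2[OF m(2)] by simp
  qed
  \<comment> \<open>Each \<open>P i\<close> is \<open>(i, k)\<close>-insensitive, and so is its
    negation. Hence \<open>C j\<close>, where \<open>j\<close> is the first failure, is an
    intersection of insensitive sets, and these pieces partition the complement of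
    \<open>D y\<close>.\<close>
  define P where "P i x \<longleftrightarrow> repl k i x @ y \<in> A" for i x
  define C where "C j = {x. (\<forall>i<j. P i x) \<and> \<not> P j x}" for j
  define f where "f x = of_bool (x \<in> B) - (\<delta> + \<gamma>)" for x
  have Dy: "D y = {x. \<forall>j<k. P j x}" by (simp add: D_def P_def)
  \<comment> \<open>\<open>B\<close> has almost critical measure but nearly avoids
    \<open>D y\<close>, of measure at least \<open>\<beta> / 2\<close>. So it exceeds the density
    \<open>\<delta> + \<gamma>\<close> on the complement of \<open>D y\<close>.\<close>
  have "real k * \<kappa> \<le> (\<Sum>j<k. ?F (\<lambda>x. f x * of_bool (x \<in> C j)))"
  proof -
    have "(\<Sum>j<k. ?F (\<lambda>x. f x * of_bool (x \<in> C j))) = ?F (\<lambda>x. f x * (\<Sum>j<k. of_bool (x \<in> C j)))"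
      by (simp only: expct_sum[symmetric] sum_distrib_left)
    also have "\<dots> = ?F (\<lambda>x. f x * (1 - of_bool (x \<in> D y)))"
      by (simp add: C_def Dy sum_first_failure)
    also have "\<dots> = ?F (\<lambda>x. (of_bool (x \<in> B) - of_bool (x \<in> B) * of_bool (x \<in> D y)) -
        ((\<delta> + \<gamma>) - (\<delta> + \<gamma>) * of_bool (x \<in> D y)))"
      by (simp add: f_def algebra_simps)
    also have "\<dots> = FB - ?F (\<lambda>x. of_bool (x \<in> B) * of_bool (x \<in> D y)) - ((\<delta> + \<gamma>) - (\<delta> + \<gamma>) * FD)"
      by (simp only: expct_diff expct_cmult expct_const[OF \<nu>(1)] FB_def FD_def)
    finally have eq: "(\<Sum>j<k. ?F (\<lambda>x. f x * of_bool (x \<in> C j))) = \<dots>" .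
    have "(\<delta> + \<gamma>) * (\<beta> / 2) \<le> (\<delta> + \<gamma>) * FD" using FD \<delta> \<gamma> by (intro mult_left_mono) auto
    moreover have "\<epsilon> + 6 * \<epsilon> / \<beta> \<le> \<delta> * \<beta> / 8" using \<epsilon>(3) by (simp add: algebra_simps)
    moreover have "(\<delta> + \<gamma>) * (\<beta> / 2) \<ge> \<delta> * \<beta> / 2" using \<gamma> \<beta> by (simp add: algebra_simps)
    moreover have "real k * \<kappa> = \<delta> * \<beta> / 4" using k by (simp add: \<kappa>_def)
    moreover have "\<gamma> = \<delta> * \<beta> / 8" by (simp add: \<gamma>_def)
    ultimately show ?thesis using FBD FB' unfolding eq by linarith
  qed
  then have "\<exists>j<k. \<kappa> \<le> ?F (\<lambda>x. f x * of_bool (x \<in> C j))"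
  proof (rule contrapos_pp)
    assume "\<not> (\<exists>j<k. \<kappa> \<le> ?F (\<lambda>x. f x * of_bool (x \<in> C j)))"
    then have "(\<Sum>j<k. ?F (\<lambda>x. f x * of_bool (x \<in> C j))) < (\<Sum>j<k. \<kappa>)"
      using k by (intro sum_strict_mono) (auto simp: not_le lessThan_empty_iff)
    then show "\<not> real k * \<kappa> \<le> (\<Sum>j<k. ?F (\<lambda>x. f x * of_bool (x \<in> C j)))" by simp
  qed
  then obtain j where j: "j < k" "\<kappa> \<le> ?F (\<lambda>x. f x * of_bool (x \<in> C j))" by blast
  have "\<forall>x\<in>words ?K m. f x * of_bool (x \<in> C j) \<le> 1"
    using \<delta> \<gamma> by (auto simp: f_def of_bool_def)
  \<comment> \<open>Back from \<nu> to the uniform measure on a coordinate subspace, at the cost of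
    half of \<kappa>.\<close>
  from N1[OF m(1) \<nu>(1,2) this less_imp_le[OF \<kappa>] j(2)] obtain T where
    T: "T \<in> words (Suc ?K) m" "M \<le> count_list T ?K"
    "\<kappa> - \<kappa> / 2 \<le> expct ?K ?u (count_list T ?K) (\<lambda>z. f (fill ?K T z) * of_bool (fill ?K T z \<in> C j))"
    by blast
  define r where "r = count_list T ?K"
  \<comment> \<open>Letters after \<open>j\<close> get \<open>UNIV\<close>, so that there is one
    insensitive set for each letter below \<open>k\<close>.\<close>
  define C' where "C' i = (if i < j then {z. P i (fill ?K T z)}
      else if i = j then {z. \<not> P i (fill ?K T z)} else UNIV)" for i
  have P: "insensitive k i m {x. P i x}" if "i < k" for i
    using that by (auto simp: insensitive_def P_def repl_repl)
  have "expct ?K ?u r (\<lambda>z. f (fill ?K T z) * of_bool (\<forall>i\<in>{..<k}. z \<in> C' i)) \<le> \<kappa> / 4"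
  proof (rule M)
    show "r \<ge> M" using T(2) by (simp add: r_def)
    show "\<forall>i\<in>{..<k}. insensitive k i r (C' i)"
    proof
      fix i assume "i \<in> {..<k}"
      then have "insensitive k i r {z. P i (fill ?K T z)}"
        using insensitive_fill[OF P _ T(1), of i] by (simp add: r_def)
      then show "insensitive k i r (C' i)" by (auto simp: C'_def insensitive_def)
    qed
    show "\<forall>x\<in>words ?K r. f (fill ?K T x) \<le> 1" using \<delta> \<gamma> by (auto simp: f_def of_bool_def)
    show "nonpos_on_subspaces ?K d r UNIV (\<lambda>z. f (fill ?K T z))"
      unfolding nonpos_on_subspaces_def
    proof (intro ballI impI)
      fix V assume V: "V \<in> subspaces ?K d r"
      \<comment> \<open>On any \<open>d\<close>-dimensional subspace the trace of \<open>B\<close>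
        is line-free, so by the choice of \<open>d\<close> its density is at most
        \<open>\<delta> + \<gamma>\<close>.\<close>
      have "\<not> has_line ?K d {z. inst ?K V z \<in> {z. fill ?K T z \<in> B}}"
        using B has_line_fill[OF T(1), of B] has_line_inst[OF V, of "{z. fill ?K T z \<in> B}"]
        by (auto simp: r_def)
      from d[OF this] show "expct ?K ?u d (\<lambda>z. f (fill ?K T (inst ?K V z))) \<le> 0"
        unfolding f_def expct_diff expct_const[OF u] by (simp add: dens_def)
    qed
  qed
  moreover have "(\<forall>i\<in>{..<k}. z \<in> C' i) \<longleftrightarrow> fill ?K T z \<in> C j" for z
    using j(1) by (auto simp: C'_def C_def)
  ultimately show False using T(3) \<kappa> by (simp add: r_def)
qed

lemma DHJ_1: "DHJ 1"
  unfolding DHJ_def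
proof (intro allI impI)
  fix \<delta> :: real assume \<delta>: "\<delta> > 0"
  have "has_line 1 n A" if "n \<ge> 1" "\<delta> \<le> dens 1 n A" for n A
  proof -
    have "0 < dens 1 n A" using that \<delta> by linarith
    then obtain x where x: "x \<in> words 1 n" "x \<in> A" using dens_exists by blast
    then have "x = replicate n 0"
      by (intro replicate_eqI) (auto simp: words_def)
    with x that(1) show ?thesis
      unfolding has_line_def by (intro bexI[of _ "replicate n 1"]) (auto simp: words_def repl_def)
  qed
  then show "\<exists>N. \<forall>n\<ge>N. \<forall>A. \<delta> \<le> dens 1 n A \<longrightarrow> has_line 1 n A" by blast
qed

theorem density_Hales_Jewett: "k \<ge> 1 \<Longrightarrow> DHJ k"
  by (induction k rule: dec_induct) (auto intro: DHJ_1 DHJ_Suc simp flip: One_nat_def)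

section \<open>Progressions with large common difference\<close>

text \<open>Makes letter sums along a line a progression whose difference is the number of wildcard
  positions.\<close>

lemma sum_list_repl:
  "sum_list (repl k j w) = sum_list (filter (\<lambda>a. a \<noteq> k) w) + j * count_list w k"
  by (induction w) (auto simp: repl_def)

text \<open>For each word \<open>x\<close> at least \<open>\<delta> / 2 * real M\<close> of the
  \<open>a\<close> up to \<open>M\<close> satisfy \<open>a + L * sum_list x \<in> A\<close>.
  Averaging over \<open>x\<close> gives one \<open>a\<close> for which the set of such words has
  density at least \<open>\<delta> / 2\<close>; a line in it yields a progression whose difference
  is \<open>L\<close> times a positive number.\<close>

lemma Szemeredi_large_difference:
  assumes "k \<ge> 1" "upper_density A > 0"
  shows "\<exists>a d. L \<le> d \<and> (\<forall>j<k. a + j * d \<in> A)"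
proof -
  have u: "prob_weights k (unif k)" by (rule prob_weights_unif[OF assms(1)])
  obtain \<delta> :: real where \<delta>: "0 < \<delta>" "ereal \<delta> < upper_density A"
    using ereal_dense2[OF assms(2)] by (auto simp: less_ereal.simps(1) zero_ereal_def)
  have freq: "\<exists>M\<ge>M0. \<delta> < real (card (A \<inter> {1..M})) / real M" for M0
  proof (rule ccontr)
    assume "\<not> ?thesis"
    then have "eventually (\<lambda>M. ereal (real (card (A \<inter> {1..M})) / real M) \<le> ereal \<delta>) sequentially"
      unfolding eventually_sequentially by (auto simp: not_less)
    then have "upper_density A \<le> ereal \<delta>" unfolding upper_density_def by (rule Limsup_bounded)
    with \<delta>(2) show False by simp
  qed
  have "\<delta> / 2 > 0" using \<delta> by simp
  then obtain n where n: "\<And>B. \<delta> / 2 \<le> dens k n B \<Longrightarrow> has_line k n B"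
    using density_Hales_Jewett[OF assms(1)] unfolding DHJ_def by blast
  \<comment> \<open>Makes the largest shift, at most \<open>L * (n * k)\<close>, cost at most half
    of the \<open>\<delta> * real M\<close> elements; \<open>Suc\<close> keeps \<open>M\<close>
    positive.\<close>
  define M0 where "M0 = Suc (nat \<lceil>real (L * (n * k)) / (\<delta> / 2)\<rceil>)"
  obtain M where M: "M \<ge> M0" "\<delta> < real (card (A \<inter> {1..M})) / real M" using freq by blast
  have Mpos: "M > 0" using M(1) by (simp add: M0_def)
  have size: "real (L * (n * k)) \<le> \<delta> / 2 * real M"
  proof -
    have "real (L * (n * k)) / (\<delta> / 2) \<le> real M" using M(1) unfolding M0_def by linarith
    then show ?thesis using \<delta>(1) by (simp add: divide_le_eq mult.commute)
  qed
  have MA: "\<delta> * real M \<le> real (card (A \<inter> {1..M}))"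
    using M(2) Mpos by (simp add: less_divide_eq)
  have count: "\<delta> / 2 * real M \<le> (\<Sum>a\<in>{1..M}. of_bool (a + L * sum_list x \<in> A))"
    if x: "x \<in> words k n" for x
  proof -
    define s where "s = L * sum_list x"
    have "sum_list x \<le> n * k"
      using sum_list_mono[of x "\<lambda>a. a" "\<lambda>_. k"] words_set[OF x] words_length[OF x]
      by (auto simp: sum_list_triv less_imp_le)
    then have s: "real s \<le> \<delta> / 2 * real M"
      using size by (smt (verit, best) mult_le_mono2 of_nat_le_iff s_def)
    have "(\<lambda>b. b - s) ` (A \<inter> {s + 1..M}) \<subseteq> {a \<in> {1..M}. a + s \<in> A}" by auto
    moreover have "inj_on (\<lambda>b. b - s) (A \<inter> {s + 1..M})" by (auto simp: inj_on_def)
    ultimately have "card (A \<inter> {s + 1..M}) \<le> card {a \<in> {1..M}. a + s \<in> A}"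
      using card_inj_on_le[of "\<lambda>b. b - s" "A \<inter> {s + 1..M}" "{a \<in> {1..M}. a + s \<in> A}"] by simp
    moreover have "card (A \<inter> {1..M}) \<le> card (A \<inter> {s + 1..M}) + s"
    proof -
      have "A \<inter> {1..M} \<subseteq> (A \<inter> {s + 1..M}) \<union> {1..s}" by auto
      then have "card (A \<inter> {1..M}) \<le> card ((A \<inter> {s + 1..M}) \<union> {1..s})" by (intro card_mono) auto
      also have "\<dots> \<le> card (A \<inter> {s + 1..M}) + card {1..s}" by (rule card_Un_le)
      finally show ?thesis by simp
    qed
    ultimately have "\<delta> / 2 * real M \<le> real (card {a \<in> {1..M}. a + s \<in> A})"
      using MA s by linarith
    also have "\<dots> = (\<Sum>a\<in>{1..M}. of_bool (a + s \<in> A))"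
    proof -
      have "{a \<in> {1..M}. a + s \<in> A} = {1..M} \<inter> {a. a + s \<in> A}" by blast
      then show ?thesis by (simp only: sum_of_bool_eq finite_atLeastAtMost)
    qed
    finally show ?thesis by (simp add: s_def)
  qed
  have "\<delta> / 2 * real M = expct k (unif k) n (\<lambda>_. \<delta> / 2 * real M)" by (simp only: expct_const[OF u])
  also have "\<dots> \<le> expct k (unif k) n (\<lambda>x. \<Sum>a\<in>{1..M}. of_bool (a + L * sum_list x \<in> A))"
    using count by (intro expct_mono[OF u])
  also have "\<dots> = (\<Sum>a\<in>{1..M}. dens k n {x. a + L * sum_list x \<in> A})"
    by (simp only: expct_sum dens_def mem_Collect_eq)
  finally have le: "\<delta> / 2 * real M \<le> \<dots>" .
  have "\<exists>a\<in>{1..M}. \<delta> / 2 \<le> dens k n {x. a + L * sum_list x \<in> A}"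
  proof (rule ccontr)
    assume "\<not> ?thesis"
    then have "(\<Sum>a\<in>{1..M}. dens k n {x. a + L * sum_list x \<in> A}) < (\<Sum>a\<in>{1..M}. \<delta> / 2)"
      using Mpos by (intro sum_strict_mono) (auto simp: not_le)
    with le show False by (simp add: mult.commute)
  qed
  then obtain a where "has_line k n {x. a + L * sum_list x \<in> A}" using n by blast
  then obtain w where w: "k \<in> set w" "\<And>j. j < k \<Longrightarrow> a + L * sum_list (repl k j w) \<in> A"
    by (auto simp: has_line_def)
  have "count_list w k > 0" using w(1) by (metis count_list_0_iff gr0I)
  then show ?thesis
    using w(2)
    by (intro exI[of _ "a + L * sum_list (filter (\<lambda>a. a \<noteq> k) w)"] exI[of _ "L * count_list w k"])
       (auto simp: sum_list_repl algebra_simps)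
qed

section \<open>Multiples of almost every real number\<close>

text \<open>
  On every period of length \<open>1 / d\<close> the set misses the fixed proportion \<open>e\<close>; taking
  \<open>d\<close> so large that the periods that meet the set lie in a close open neighbourhood of it
  shows that it is null.
\<close>

lemma negligible_avoid_interval:
  fixes D :: "nat set" and p q :: real
  assumes D: "\<And>L. \<exists>d\<in>D. L \<le> d" and pq: "p < q"
  shows "negligible {\<alpha>::real. \<forall>d\<in>D. \<forall>n::int. \<not> (p < real d * \<alpha> - of_int n \<and> real d * \<alpha> - of_int n < q)}"
    (is "negligible ?E")
proof -
  \<comment> \<open>Capped at 1, the length of a period in the scale of
    \<open>real d * \<alpha>\<close>.\<close>
  define e where "e = min (q - p) 1"
  have e: "0 < e" "e \<le> 1" "p + e \<le> q" using pq by (auto simp: e_def)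
  have closed: "closed ?E"
  proof -
    have "closed (\<Inter>d\<in>D. \<Inter>n::int. {\<alpha>. real d * \<alpha> - of_int n \<le> p} \<union> {\<alpha>. q \<le> real d * \<alpha> - of_int n})"
      by (intro closed_INT ballI closed_Un closed_Collect_le continuous_intros)
    also have "(\<Inter>d\<in>D. \<Inter>n::int. {\<alpha>. real d * \<alpha> - of_int n \<le> p} \<union> {\<alpha>. q \<le> real d * \<alpha> - of_int n}) = ?E"
      by (auto simp: not_less)
    finally show ?thesis .
  qed
  have "negligible (?E \<inter> {- real R..real R})" for R :: nat
  proof -
    define F where "F = ?E \<inter> {- real R..real R}"
    have cF: "compact F" unfolding F_def by (rule closed_Int_compact[OF closed]) simp
    then have mF: "F \<in> lmeasurable" by (rule lmeasurable_compact)
    \<comment> \<open>The cover below gives \<open>measure lebesgue F\<close> at most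
      \<open>(1 - e) * (measure lebesgue F + \<eta>)\<close>; then \<eta> tends to 0.\<close>
    have main: "e * measure lebesgue F \<le> \<eta>" if \<eta>: "\<eta> > 0" for \<eta>
    proof -
      obtain U where U: "open U" "F \<subseteq> U" "U \<in> lmeasurable" "measure lebesgue U < measure lebesgue F + \<eta>"
      proof -
        obtain U where U: "open U" "F \<subseteq> U" "U - F \<in> lmeasurable" "emeasure lebesgue (U - F) < ennreal \<eta>"
          using sets_lebesgue_outer_open[OF fmeasurableD[OF mF] \<eta>] by blast
        have "F \<union> (U - F) = U" using U(2) by blast
        then have "U \<in> lmeasurable" "measure lebesgue U \<le> measure lebesgue F + measure lebesgue (U - F)"
          using fmeasurable.Un[OF mF U(3)] measure_Un_le[OF fmeasurableD[OF mF] fmeasurableD[OF U(3)]]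
          by simp_all
        moreover have "measure lebesgue (U - F) < \<eta>"
          using U(3,4) \<eta> by (simp add: emeasure_eq_measure2 ennreal_less_iff)
        ultimately show thesis using that[OF U(1,2)] by linarith
      qed
      obtain r where r: "r > 0" "(\<Union>x\<in>F. ball x r) \<subseteq> U"
        using compact_subset_open_imp_ball_epsilon_subset[OF cF U(1,2)] by metis
      obtain d where d: "d \<in> D" "Suc (nat \<lceil>1 / r\<rceil>) \<le> d" using D by blast
      have d0: "real d > 0" "1 / real d < r"
      proof -
        show "real d > 0" using d(2) by simp
        have "1 / r < real d" using d(2) by linarith
        then show "1 / real d < r" using r(1) \<open>real d > 0\<close> by (simp add: field_simps)
      qed
      \<comment> \<open>The periods \<open>J n\<close> partition the line. A point of
        \<open>F\<close> in \<open>J n\<close> lies in the shorter \<open>I n\<close> or is the left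
        end of \<open>J n\<close>; these ends form the finite set \<open>Z\<close>.\<close>
      define J where "J n = {(of_int n + p) / real d..<(of_int n + p + 1) / real d}" for n :: int
      define I where "I n = {(of_int n + p + e) / real d..(of_int n + p + 1) / real d}" for n :: int
      define c where "c \<alpha> = \<lfloor>real d * \<alpha> - p\<rfloor>" for \<alpha>
      have J: "\<alpha> \<in> J n \<longleftrightarrow> c \<alpha> = n" for \<alpha> n
      proof -
        have "\<alpha> \<in> J n \<longleftrightarrow> of_int n \<le> real d * \<alpha> - p \<and> real d * \<alpha> - p < of_int n + 1"
          using d0(1) by (auto simp: J_def field_simps)
        then show ?thesis unfolding c_def by (simp add: floor_eq_iff)
      qed
      define H where "H = c ` F"
      have finH: "finite H"
      proof (rule finite_subset)
        show "H \<subseteq> {\<lfloor>real d * (- real R) - p\<rfloor>..\<lfloor>real d * real R - p\<rfloor>}"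
        proof
          fix n assume "n \<in> H"
          then obtain \<alpha> where \<alpha>: "- real R \<le> \<alpha>" "\<alpha> \<le> real R" "n = c \<alpha>" by (auto simp: H_def F_def)
          have "real d * (- real R) \<le> real d * \<alpha>" "real d * \<alpha> \<le> real d * real R"
            using \<alpha> d0 by (intro mult_left_mono; simp)+
          then show "n \<in> {\<lfloor>real d * (- real R) - p\<rfloor>..\<lfloor>real d * real R - p\<rfloor>}"
            unfolding \<alpha>(3) c_def atLeastAtMost_iff by (intro conjI floor_mono) auto
        qed
      qed simp
      have JU: "J n \<subseteq> U" if n: "n \<in> H" for n
      proof
        fix y assume y: "y \<in> J n"
        obtain x where x: "x \<in> F" "x \<in> J n" using n J by (auto simp: H_def)
        have "\<bar>y - x\<bar> < 1 / real d"
          using x(2) y d0(1) unfolding J_def by (auto simp: abs_less_iff field_simps)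
        then have "y \<in> ball x r" using d0(2) by (simp add: dist_real_def abs_minus_commute)
        with x(1) r(2) show "y \<in> U" by blast
      qed
      have mJ: "measure lebesgue (J n) = 1 / real d" "J n \<in> lmeasurable" for n
      proof -
        show "measure lebesgue (J n) = 1 / real d"
          using d0(1) by (simp add: J_def field_simps)
        show "J n \<in> lmeasurable"
          unfolding J_def by (intro bounded_set_imp_lmeasurable) auto
      qed
      have mI: "measure lebesgue (I n) = (1 - e) / real d" "I n \<in> lmeasurable" for n
        using d0(1) e by (auto simp: I_def divide_right_mono diff_divide_distrib[symmetric])
      have "real (card H) / real d = (\<Sum>n\<in>H. measure lebesgue (J n))" by (simp add: mJ)
      also have "\<dots> = measure lebesgue (\<Union>n\<in>H. J n)"
      proof (rule measure_finite_Union[symmetric, OF finH])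
        show "J ` H \<subseteq> sets lebesgue" using mJ(2) by auto
        show "disjoint_family_on J H" unfolding disjoint_family_on_def by (auto simp: J)
        show "emeasure lebesgue (J n) \<noteq> \<infinity>" for n using mJ(2)[of n] by (auto simp: fmeasurable_def)
      qed
      also have "\<dots> \<le> measure lebesgue U"
        using JU finH mJ(2) by (intro measure_mono_fmeasurable U(3)) (auto intro!: sets.finite_UN)
      finally have cardH: "real (card H) / real d \<le> measure lebesgue F + \<eta>" using U(4) by linarith
      define Z where "Z = (\<lambda>n::int. (of_int n + p) / real d) ` H"
      have Z: "negligible Z" unfolding Z_def using finH by (intro negligible_finite) simp
      have "F \<subseteq> (\<Union>n\<in>H. I n) \<union> Z"
      proof
        fix \<alpha> assume \<alpha>: "\<alpha> \<in> F"
        define n where "n = c \<alpha>"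
        have n: "n \<in> H" "\<alpha> \<in> J n" using \<alpha> J by (auto simp: H_def n_def)
        have "\<not> (p < real d * \<alpha> - of_int n \<and> real d * \<alpha> - of_int n < q)"
          using \<alpha> d(1) by (auto simp: F_def)
        moreover have "p \<le> real d * \<alpha> - of_int n" "real d * \<alpha> - of_int n < p + 1"
          using n(2) d0(1) by (auto simp: J_def field_simps)
        ultimately have "real d * \<alpha> - of_int n = p \<or> p + e \<le> real d * \<alpha> - of_int n" using e by linarith
        then show "\<alpha> \<in> (\<Union>n\<in>H. I n) \<union> Z"
        proof
          assume "real d * \<alpha> - of_int n = p"
          then have "\<alpha> = (of_int n + p) / real d" using d0(1) by (simp add: field_simps)
          with n show ?thesis by (auto simp: Z_def)
        next
          assume "p + e \<le> real d * \<alpha> - of_int n"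
          then have "\<alpha> \<in> I n" using n(2) d0(1) by (auto simp: I_def J_def field_simps)
          with n show ?thesis by auto
        qed
      qed
      then have "measure lebesgue F \<le> measure lebesgue ((\<Union>n\<in>H. I n) \<union> Z)"
        using Z mF mI(2) finH
        by (intro measure_mono_fmeasurable fmeasurable.Un fmeasurable.finite_UN)
           (auto simp: negligible_iff_measure)
      also have "\<dots> \<le> measure lebesgue (\<Union>n\<in>H. I n) + measure lebesgue Z"
        using Z mI(2) finH
        by (intro measure_Un_le) (auto simp: negligible_iff_measure intro!: sets.finite_UN)
      also have "measure lebesgue Z = 0" using Z by (simp add: negligible_iff_measure)
      also have "measure lebesgue (\<Union>n\<in>H. I n) \<le> (\<Sum>n\<in>H. measure lebesgue (I n))"
        using finH mI(2) by (intro measure_UNION_le) auto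
      also have "\<dots> = (1 - e) * (real (card H) / real d)" by (simp add: mI)
      also have "\<dots> \<le> (1 - e) * (measure lebesgue F + \<eta>)"
        using cardH e by (intro mult_left_mono) auto
      also have "\<dots> \<le> (1 - e) * measure lebesgue F + \<eta>"
        using e \<eta> by (simp add: algebra_simps)
      finally show ?thesis by (simp add: algebra_simps)
    qed
    have "e * measure lebesgue F \<le> 0"
      using main by (rule field_le_epsilon[of _ 0, simplified])
    then have "measure lebesgue F = 0"
      using e(1) measure_nonneg[of lebesgue F] by (simp add: mult_le_0_iff)
    then show ?thesis using mF unfolding F_def[symmetric] by (simp add: negligible_iff_measure)
  qed
  then have "negligible (\<Union>R::nat. ?E \<inter> {- real R..real R})" by (rule negligible_Union_nat)
  moreover have "?E \<subseteq> (\<Union>R::nat. ?E \<inter> {- real R..real R})"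
  proof
    fix \<alpha> assume \<alpha>: "\<alpha> \<in> ?E"
    obtain R :: nat where "\<bar>\<alpha>\<bar> \<le> real R" using real_arch_simple by blast
    then have "\<alpha> \<in> {- real R..real R}" by auto
    with \<alpha> show "\<alpha> \<in> (\<Union>R::nat. ?E \<inter> {- real R..real R})" by blast
  qed
  ultimately show ?thesis by (rule negligible_subset)
qed

text \<open>Applied to \<alpha> = \<open>1 / \<bar>\<theta>\<bar>\<close>. The maps sending \<alpha>
  to its inverse and to minus its inverse are differentiable off 0, so they preserve null sets, and
  rational endpoints leave countably many exceptional sets.\<close>

lemma AE_multiples_hit_intervals:
  fixes D :: "nat set"
  assumes D: "\<And>L. \<exists>d\<in>D. L \<le> d"
  shows "AE \<theta> in lebesgue. \<theta> \<noteq> (0::real) \<and>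
    (\<forall>s t. s < t \<longrightarrow> (\<exists>d\<in>D. \<exists>n::nat. n \<ge> 1 \<and>
        s < real d / \<bar>\<theta>\<bar> - real n \<and> real d / \<bar>\<theta>\<bar> - real n < t))"
proof -
  define E where "E p q L = {\<alpha>::real. \<forall>d\<in>D \<inter> {L..}. \<forall>n::int.
      \<not> (p < real d * \<alpha> - of_int n \<and> real d * \<alpha> - of_int n < q)}" for p q :: real and L :: nat
  define N where "N p q L = inverse ` (E p q L - {0}) \<union> (\<lambda>x. - inverse x) ` (E p q L - {0})" for p q L
  have N: "negligible (N p q L)" if "p < q" for p q L
  proof -
    have "\<exists>d\<in>D \<inter> {L..}. L' \<le> d" for L'
      using D[of "max L L'"] by auto
    then have E: "negligible (E p q L - {0})"
      unfolding E_def using negligible_avoid_interval[OF _ that, of "D \<inter> {L..}"]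
      by (meson Diff_subset negligible_subset)
    show ?thesis
      unfolding N_def
      by (intro negligible_Un negligible_differentiable_image_negligible[OF order.refl E])
         (auto intro!: differentiable_on_minus differentiable_on_inverse differentiable_on_ident)
  qed
  define Bad where "Bad = insert 0 (\<Union>(p, q, L) \<in> {(p, q, L). p \<in> \<rat> \<and> q \<in> \<rat> \<and> p < q}. N p q L)"
  have "negligible Bad"
  proof -
    have "{(p, q, L). p \<in> \<rat> \<and> q \<in> \<rat> \<and> p < q} \<subseteq> (\<rat> :: real set) \<times> (\<rat> :: real set) \<times> (UNIV :: nat set)"
      by auto
    then have "countable {(p :: real, q :: real, L :: nat). p \<in> \<rat> \<and> q \<in> \<rat> \<and> p < q}"
      by (rule countable_subset) (intro countable_SIGMA countable_rat countableI_type)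
    then have "negligible (\<Union>(p, q, L) \<in> {(p, q, L). p \<in> \<rat> \<and> q \<in> \<rat> \<and> p < q}. N p q L)"
      by (intro negligible_countable_Union) (auto intro: N)
    then show ?thesis by (simp add: Bad_def negligible_insert)
  qed
  moreover have "\<theta> \<noteq> 0 \<and> (\<forall>s t. s < t \<longrightarrow> (\<exists>d\<in>D. \<exists>n::nat. n \<ge> 1 \<and>
        s < real d / \<bar>\<theta>\<bar> - real n \<and> real d / \<bar>\<theta>\<bar> - real n < t))"
    if \<theta>: "\<theta> \<notin> Bad" for \<theta> :: real
  proof (intro conjI allI impI)
    show \<theta>0: "\<theta> \<noteq> 0" using \<theta> by (auto simp: Bad_def)
    fix s t :: real assume st: "s < t"
    obtain q where q: "q \<in> \<rat>" "s < q" "q < t" using Rats_dense_in_real[OF st] by blast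
    obtain p where p: "p \<in> \<rat>" "s < p" "p < q" using Rats_dense_in_real[OF q(2)] by blast
    \<comment> \<open>For \<open>d\<close> at least \<open>L\<close> the quotient
      \<open>real d / \<bar>\<theta>\<bar>\<close> is at least \<open>q\<close>, which forces the
      integer \<open>n\<close> to be positive.\<close>
    obtain L :: nat where L: "q * \<bar>\<theta>\<bar> \<le> real L" using real_arch_simple by blast
    have "\<theta> \<notin> N p q L" using \<theta> p q by (auto simp: Bad_def)
    moreover have "\<theta> \<in> N p q L" if "inverse \<bar>\<theta>\<bar> \<in> E p q L"
    proof (cases "\<theta> > 0")
      case True
      then have "\<theta> = inverse (inverse \<bar>\<theta>\<bar>)" "inverse \<bar>\<theta>\<bar> \<noteq> 0" by auto
      with that show ?thesis unfolding N_def by blast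
    next
      case False
      then have "\<theta> = - inverse (inverse \<bar>\<theta>\<bar>)" "inverse \<bar>\<theta>\<bar> \<noteq> 0" using \<theta>0 by auto
      with that show ?thesis unfolding N_def by blast
    qed
    ultimately have "inverse \<bar>\<theta>\<bar> \<notin> E p q L" by blast
    then obtain d n where dn: "d \<in> D" "d \<ge> L" "p < real d / \<bar>\<theta>\<bar> - of_int n" "real d / \<bar>\<theta>\<bar> - of_int n < q"
      by (auto simp: E_def divide_inverse)
    have "q \<le> real d / \<bar>\<theta>\<bar>"
      using L dn(2) \<theta>0 by (simp add: le_divide_eq)
    then have "of_int n > (0::real)" using dn(4) by linarith
    then have n: "real (nat n) = of_int n" "nat n \<ge> 1" by auto
    show "\<exists>d\<in>D. \<exists>n::nat. n \<ge> 1 \<and> s < real d / \<bar>\<theta>\<bar> - real n \<and> real d / \<bar>\<theta>\<bar> - real n < t"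
      using dn p q n by (intro bexI[of _ d] exI[of _ "nat n"]) auto
  qed
  ultimately show ?thesis
    unfolding negligible_iff_null_sets by (intro AE_I'[of Bad]) blast+
qed

section \<open>Common differences in Beatty sequences\<close>

theorem corollary2p6:
  fixes k :: nat and A :: "nat set"
  assumes "k \<ge> 1"
    and "A \<subseteq> {1..}"
    and "upper_density A > 0"
  shows "AE \<theta> in lebesgue. \<forall>\<gamma>::real. \<exists>d\<in>beatty \<theta> \<gamma>. \<exists>P. is_AP k d P \<and> P \<subseteq> int ` A"
proof -
  define D where "D = {d. d \<ge> 1 \<and> (\<exists>a. \<forall>j<k. a + j * d \<in> A)}"
  \<comment> \<open>The bound \<open>max 1 L\<close> keeps the differences nonzero.\<close>
  have "\<exists>d\<in>D. L \<le> d" for L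
    using Szemeredi_large_difference[OF assms(1,3), of "max 1 L"] by (auto simp: D_def)
  from AE_multiples_hit_intervals[OF this] show ?thesis
  proof (rule AE_mp, intro AE_I2 impI allI)
    fix \<theta> \<gamma> :: real
    assume h: "\<theta> \<noteq> 0 \<and> (\<forall>s t. s < t \<longrightarrow> (\<exists>d\<in>D. \<exists>n::nat. n \<ge> 1 \<and>
        s < real d / \<bar>\<theta>\<bar> - real n \<and> real d / \<bar>\<theta>\<bar> - real n < t))"
    show "\<exists>d\<in>beatty \<theta> \<gamma>. \<exists>P. is_AP k d P \<and> P \<subseteq> int ` A"
    proof (cases "\<theta> > 0")
      case True
      \<comment> \<open>The floor equals \<open>d\<close> when
        \<open>d \<le> \<theta> * n + \<gamma> < d + 1\<close>; dividing by \<theta> places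
        \<open>d / \<theta> - n\<close> between these two endpoints.\<close>
      have "(\<gamma> - 1) / \<theta> < \<gamma> / \<theta>" using True by (simp add: divide_strict_right_mono)
      then obtain d n where dn: "d \<in> D" "n \<ge> 1" "(\<gamma> - 1) / \<theta> < real d / \<theta> - real n"
          "real d / \<theta> - real n < \<gamma> / \<theta>"
        using h[THEN conjunct2, rule_format, of "(\<gamma> - 1) / \<theta>" "\<gamma> / \<theta>"] True by auto
      have "real d \<le> \<theta> * real n + \<gamma>" "\<theta> * real n + \<gamma> < real d + 1"
        using mult_strict_left_mono[OF dn(3) True] mult_strict_left_mono[OF dn(4) True] True
        by (simp_all add: right_diff_distrib[of _ "_ / _"])
      then have "\<lfloor>\<theta> * real n + \<gamma>\<rfloor> = int d" by (simp add: floor_eq_iff)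
      then have "int d \<in> beatty \<theta> \<gamma>" using dn(2) by (auto simp: beatty_def intro!: exI[of _ n])
      moreover obtain a where a: "\<And>j. j < k \<Longrightarrow> a + j * d \<in> A" "d \<ge> 1" using dn(1) by (auto simp: D_def)
      have "is_AP k (int d) {int a + int i * int d | i. i < k}"
        using a(2) by (auto simp: is_AP_def)
      moreover have "{int a + int i * int d | i. i < k} \<subseteq> int ` A"
      proof safe
        fix i assume "i < k"
        then show "int a + int i * int d \<in> int ` A"
          by (intro image_eqI[OF _ a(1)[of i]]) auto
      qed
      ultimately show ?thesis by blast
    next
      case False
      then have \<theta>: "\<theta> < 0" using h by auto
      \<comment> \<open>Now the floor is to equal \<open>- d\<close>; dividing by the negative
        \<theta> exchanges the endpoints.\<close>
      have "\<gamma> / \<theta> < (\<gamma> - 1) / \<theta>" using \<theta> by (simp add: divide_strict_right_mono_neg)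
      then obtain d n where dn: "d \<in> D" "n \<ge> 1" "\<gamma> / \<theta> < real d / (- \<theta>) - real n"
          "real d / (- \<theta>) - real n < (\<gamma> - 1) / \<theta>"
        using h[THEN conjunct2, rule_format, of "\<gamma> / \<theta>" "(\<gamma> - 1) / \<theta>"] \<theta> by auto
      have "- real d \<le> \<theta> * real n + \<gamma>" "\<theta> * real n + \<gamma> < - real d + 1"
        using mult_strict_left_mono_neg[OF dn(3) \<theta>] mult_strict_left_mono_neg[OF dn(4) \<theta>] \<theta>
        by (simp_all add: right_diff_distrib[of _ "- (_ / _)"])
      then have "\<lfloor>\<theta> * real n + \<gamma>\<rfloor> = - int d" by (simp add: floor_eq_iff)
      then have "- int d \<in> beatty \<theta> \<gamma>" using dn(2) by (auto simp: beatty_def intro!: exI[of _ n])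
      moreover obtain a where a: "\<And>j. j < k \<Longrightarrow> a + j * d \<in> A" "d \<ge> 1" using dn(1) by (auto simp: D_def)
      \<comment> \<open>The last term of the progression: going down from it gives the difference
        \<open>- d\<close>.\<close>
      define m where "m = int a + int (k - 1) * int d"
      have "is_AP k (- int d) {m + int i * (- int d) | i. i < k}"
        using a(2) by (auto simp: is_AP_def)
      moreover have "{m + int i * (- int d) | i. i < k} \<subseteq> int ` A"
      proof safe
        fix i assume i: "i < k"
        have "int (k - 1) = int i + int (k - 1 - i)" using i by simp
        then have "m = int a + (int i * int d + int (k - 1 - i) * int d)"
          unfolding m_def by (simp only: distrib_right)
        then have "m + int i * (- int d) = int (a + (k - 1 - i) * d)" by simp
        then show "m + int i * (- int d) \<in> int ` A"
          by (rule image_eqI) (use a(1)[of "k - 1 - i"] i in simp)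
      qed
      ultimately show ?thesis by blast
    qed
  qed
qed

end
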